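(* Let $i\in I_0$ and let $b\in\mathcal{B}^{\otimes\ell}$ be $\{1,2,\dots,i\}$-highest weight with $\varphi_{-i}(b)=1$. Let $b_{q_i},b_{q_{i-1}},\dots,b_{q_1}$ be the initial $i$-sequence of $b$ (so $q_i<\dots<q_1$). Set $r_1=q_1$ and recursively, for $1<j\le i$, let $r_j<r_{j-1}$ be maximal with $b_{r_j}=j$. Let $1\le k\le i$ be maximal such that $q_k=r_k$. Then $f_{-i}(b)$ is obtained from $b$ by changing $b_{q_j}=j$ to $j-1$ for $j=i,i-1,\dots,k+1$ and changing $b_{r_j}=j$ to $j+1$ for $j=i,i-1,\dots,k$.
   Context: Fix $n\ge1$, $\ell\ge1$, $I_0=\{1,\dots,n\}$. $\mathcal{B}^{\otimes\ell}$ is the set of words $b=b_1\cdots b_\ell$ with letters in $\{1,\dots,n+1\}$. Operators map to $\mathcal{B}^{\otimes\ell}\sqcup\{0\}$ and send $0$ to $0$; products denote composition (rightmost first). For $i\in I_0$: in the subsequence of letters equal to $i$ or $i+1$, repeatedly pair an $i+1$ with an $i$ immediately to its right in the current subsequence and remove the pair; $f_i$ changes the rightmost unpaired $i$ to $i+1$, $e_i$ the leftmost unpaired $i+1$ to $i$ ($0$ if none). $\varphi_i(b)=\max\{k:f_i^kb\ne0\}$, $\varepsilon_i(b)=\max\{k:e_i^kb\ne0\}$, and $s_i(b)=f_i^m(b)$ if $m=\varphi_i(b)-\varepsilon_i(b)\ge0$, $s_i(b)=e_i^{-m}(b)$ if $m<0$. $f_{-1}(b)$ changes the leftmost letter in $\{1,2\}$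 to $2$ if it is $1$ (else $0$). For $1<i\le n$: $f_{-i}=s_{i-1}\cdots s_1s_i\cdots s_2\,f_{-1}\,s_2\cdots s_is_1\cdots s_{i-1}$, and $\varphi_{-i}(b)=\max\{k:f_{-i}^kb\ne0\}$. For $J\subseteq I_0$, $b$ is $J$-highest weight if $e_j(b)=0$ for all $j\in J$. The initial $k$-sequence of $b$ (if it exists) is $b_{p_k},b_{p_{k-1}},\dots,b_{p_1}$ where $b_{p_k}$ is the leftmost letter $k$ of $b$ and, for $1\le j<k$, $b_{p_j}$ is the leftmost letter $j$ to the right of position $p_{j+1}$. *)

theory Defs
  imports Main
begin

text \<open>
  A word is a list of natural numbers, and \<open>None\<close> plays the role of the extra element 0.
  Positions in a word are list indices, so they start at 0.
\<close>

type_synonym word = "nat list"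
type_synonym operator = "word option \<Rightarrow> word option"

definition words :: "nat \<Rightarrow> nat \<Rightarrow> word set" where
  "words n l = {b. length b = l \<and> set b \<subseteq> {1..n + 1}}"

text \<open>
  The bracketing rule acts on lists of positions of letters \<open>i\<close> and \<open>i + 1\<close>: one step of it
  removes two neighbouring positions that carry \<open>i + 1\<close> and \<open>i\<close> in this order.
\<close>

inductive pair_step :: "nat \<Rightarrow> word \<Rightarrow> nat list \<Rightarrow> nat list \<Rightarrow> bool" for i b where
  "b ! p = i + 1 \<Longrightarrow> b ! q = i \<Longrightarrow> pair_step i b (us @ [p, q] @ vs) (us @ vs)"

definition bracket_positions :: "nat \<Rightarrow> word \<Rightarrow> nat list" where
  "bracket_positions i b = filter (\<lambda>p. b ! p \<in> {i, i + 1}) [0..<length b]"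

fun push :: "nat \<Rightarrow> word \<Rightarrow> nat \<Rightarrow> nat list \<Rightarrow> nat list" where
  "push i b p [] = [p]"
| "push i b p (q # qs) = (if b ! p = i + 1 \<and> b ! q = i then qs else p # q # qs)"

definition unpaired :: "nat \<Rightarrow> word \<Rightarrow> nat list" where
  "unpaired i b = foldr (push i b) (bracket_positions i b) []"

text \<open>
  \<open>unpaired\<close> computes what is left, in increasing order, when pairs are removed as long as
  possible, and the order of the removals does not matter.
\<close>

lemma pair_step_Cons: "pair_step i b xs ys \<Longrightarrow> pair_step i b (x # xs) (x # ys)"
proof (induction rule: pair_step.induct)
  case (1 p q us vs)
  then show ?case using pair_step.intros[of b p i q "x # us" vs] by simp
qed

lemma pair_steps_Cons: "(pair_step i b)\<^sup>*\<^sup>* xs ys \<Longrightarrow> (pair_step i b)\<^sup>*\<^sup>* (x # xs) (x # ys)"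
  by (induction rule: rtranclp_induct) (auto intro: pair_step_Cons rtranclp.rtrancl_into_rtrancl)

lemma pair_steps_push: "(pair_step i b)\<^sup>*\<^sup>* (x # xs) (push i b x xs)"
proof (cases xs)
  case (Cons y ys)
  then show ?thesis
    using pair_step.intros[of b x i y "[]" ys] by auto
qed auto

lemma pair_steps_foldr: "(pair_step i b)\<^sup>*\<^sup>* xs (foldr (push i b) xs [])"
proof (induction xs)
  case (Cons x xs)
  show ?case
    using rtranclp_trans[OF pair_steps_Cons[OF Cons.IH] pair_steps_push] by simp
qed auto

lemma pair_step_irreducible_push:
  assumes "\<nexists>zs. pair_step i b xs zs"
  shows "\<nexists>zs. pair_step i b (push i b x xs) zs"
proof (cases xs)
  case Nil
  then show ?thesis by (auto simp: pair_step.simps Cons_eq_append_conv)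
next
  case (Cons y ys)
  have "\<nexists>zs. pair_step i b ys zs"
    using assms pair_step_Cons unfolding Cons by blast
  moreover have "\<nexists>zs. pair_step i b (x # y # ys) zs" if "\<not> (b ! x = i + 1 \<and> b ! y = i)"
  proof
    assume "\<exists>zs. pair_step i b (x # y # ys) zs"
    then obtain us p q vs where "x # y # ys = us @ [p, q] @ vs" "b ! p = i + 1" "b ! q = i"
      by (auto simp: pair_step.simps)
    then show False
      using that assms pair_step.intros[of b p i q "tl us" vs] unfolding Cons
      by (cases us) auto
  qed
  ultimately show ?thesis unfolding Cons by auto
qed

lemma pair_step_irreducible_foldr: "\<nexists>zs. pair_step i b (foldr (push i b) xs []) zs"
proof (induction xs)
  case Nil
  show ?case by (auto simp: pair_step.simps)
next
  case (Cons x xs)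
  then show ?case using pair_step_irreducible_push by simp
qed

lemma foldr_push_irreducible:
  "\<nexists>zs. pair_step i b xs zs \<Longrightarrow> foldr (push i b) xs [] = xs"
proof (induction xs)
  case (Cons x xs)
  then have xs: "foldr (push i b) xs [] = xs"
    using pair_step_Cons by blast
  show ?case
  proof (cases xs)
    case (Cons y ys)
    then show ?thesis
      using xs Cons.prems pair_step.intros[of b x i y "[]" ys] by auto
  qed simp
qed simp

lemma foldr_push_pair_step:
  assumes "pair_step i b xs ys"
  shows "foldr (push i b) xs [] = foldr (push i b) ys []"
  using assms
proof cases
  case (1 p q us vs)
  have "push i b q zs = q # zs" for zs
    using 1 by (cases zs) auto
  then show ?thesis using 1 by simp
qed

theorem unpaired_iff:
  "ys = unpaired i b \<longleftrightarrow>
     (pair_step i b)\<^sup>*\<^sup>* (bracket_positions i b) ys \<and> (\<nexists>zs. pair_step i b ys zs)"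
proof
  assume "ys = unpaired i b"
  then show "(pair_step i b)\<^sup>*\<^sup>* (bracket_positions i b) ys \<and> (\<nexists>zs. pair_step i b ys zs)"
    using pair_steps_foldr pair_step_irreducible_foldr by (simp add: unpaired_def)
next
  assume *: "(pair_step i b)\<^sup>*\<^sup>* (bracket_positions i b) ys \<and> (\<nexists>zs. pair_step i b ys zs)"
  have "foldr (push i b) xs [] = foldr (push i b) zs []" if "(pair_step i b)\<^sup>*\<^sup>* xs zs" for xs zs
    using that by (induction rule: rtranclp_induct) (auto dest: foldr_push_pair_step)
  from this[of "bracket_positions i b" ys] foldr_push_irreducible[of i b ys] *
  show "ys = unpaired i b"
    by (auto simp: unpaired_def)
qed

definition f_op :: "nat \<Rightarrow> operator" where
  "f_op i x = Option.bind x (\<lambda>b. let ps = filter (\<lambda>p. b ! p = i) (unpaired i b)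
     in if ps = [] then None else Some (b[last ps := i + 1]))"

definition e_op :: "nat \<Rightarrow> operator" where
  "e_op i x = Option.bind x (\<lambda>b. let ps = filter (\<lambda>p. b ! p = i + 1) (unpaired i b)
     in if ps = [] then None else Some (b[hd ps := i]))"

definition max_power :: "operator \<Rightarrow> word \<Rightarrow> nat" where
  "max_power g b = Max {k. (g ^^ k) (Some b) \<noteq> None}"

abbreviation phi :: "nat \<Rightarrow> word \<Rightarrow> nat" where
  "phi i \<equiv> max_power (f_op i)"

abbreviation eps :: "nat \<Rightarrow> word \<Rightarrow> nat" where
  "eps i \<equiv> max_power (e_op i)"

definition s_op :: "nat \<Rightarrow> operator" where
  "s_op i x = Option.bind x (\<lambda>b. if eps i b \<le> phi i b
     then (f_op i ^^ (phi i b - eps i b)) (Some b)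
     else (e_op i ^^ (eps i b - phi i b)) (Some b))"

definition f_neg_one :: operator where
  "f_neg_one x = Option.bind x (\<lambda>b. let ps = filter (\<lambda>p. b ! p \<in> {1, 2}) [0..<length b]
     in if ps = [] \<or> b ! hd ps \<noteq> 1 then None else Some (b[hd ps := 2]))"

text \<open>\<open>s_prod [j\<^sub>1, ..., j\<^sub>m]\<close> is the product of \<open>s_op j\<^sub>1, ..., s_op j\<^sub>m\<close>, so
  \<open>s_op j\<^sub>m\<close> acts first.\<close>

definition s_prod :: "nat list \<Rightarrow> operator" where
  "s_prod js = foldr (\<lambda>j g. s_op j \<circ> g) js id"

text \<open>For \<open>i = 1\<close> all products are empty, and \<open>f_neg 1 = f_neg_one\<close>.\<close>

definition f_neg :: "nat \<Rightarrow> operator" where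
  "f_neg i = s_prod (rev [1..<i]) \<circ> s_prod (rev [2..<i + 1]) \<circ> f_neg_one
     \<circ> s_prod [2..<i + 1] \<circ> s_prod [1..<i]"

abbreviation phi_neg :: "nat \<Rightarrow> word \<Rightarrow> nat" where
  "phi_neg i \<equiv> max_power (f_neg i)"

definition highest_weight :: "nat set \<Rightarrow> word \<Rightarrow> bool" where
  "highest_weight J b \<longleftrightarrow> (\<forall>j\<in>J. e_op j (Some b) = None)"

text \<open>The position of the letter \<open>j\<close> of the sequence is \<open>q j\<close>; only \<open>q 1, ..., q k\<close> matter.\<close>

definition initial_seq :: "nat \<Rightarrow> word \<Rightarrow> (nat \<Rightarrow> nat) \<Rightarrow> bool" where
  "initial_seq k b q \<longleftrightarrow>
     (q k < length b \<and> b ! q k = k \<and> (\<forall>p < q k. b ! p \<noteq> k)) \<and>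
     (\<forall>j. 1 \<le> j \<and> j < k \<longrightarrow>
        q (j + 1) < q j \<and> q j < length b \<and> b ! q j = j \<and>
        (\<forall>p. q (j + 1) < p \<and> p < q j \<longrightarrow> b ! p \<noteq> j))"

definition leftward_seq :: "nat \<Rightarrow> word \<Rightarrow> nat \<Rightarrow> (nat \<Rightarrow> nat) \<Rightarrow> bool" where
  "leftward_seq i b p1 r \<longleftrightarrow>
     r 1 = p1 \<and>
     (\<forall>j. 1 < j \<and> j \<le> i \<longrightarrow>
        r j < r (j - 1) \<and> b ! r j = j \<and> (\<forall>p. r j < p \<and> p < r (j - 1) \<longrightarrow> b ! p \<noteq> j))"

end

theory Submission
  imports Defs
begin

text \<open>
  Bracketing conditions are expressed by counting positions in prefixes: if a set \<open>A\<close> of letters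
  \<open>j + 1\<close> is completely bracketed with a set \<open>B\<close> of letters \<open>j\<close>, and no bracketed pair encloses a
  position of the remaining set \<open>X\<close>, then \<open>s\<^sub>j\<close> just exchanges \<open>j\<close> and \<open>j + 1\<close> on \<open>X\<close>, provided
  \<open>X\<close> carries a single letter (\<open>s_op_balanced\<close>). For a highest weight word \<open>b\<close> let \<open>C\<^sub>i\<close> be the set of
  its letters \<open>i\<close> and \<open>C\<^sub>j\<close> the set of its letters \<open>j\<close> bracketed with \<open>C\<^sub>j\<^sub>+\<^sub>1\<close>. Then
  \<open>u = s\<^sub>1 \<cdots> s\<^sub>i\<^sub>-\<^sub>1 b\<close> raises exactly the letters \<open>j < i\<close> outside \<open>C\<^sub>j\<close>, and since \<open>u\<close> is again highest
  weight for \<open>2, \<dots>, i\<close>, the same description gives \<open>s\<^sub>2 \<cdots> s\<^sub>i u\<close>. Here \<open>f\<^sub>-\<^sub>1\<close> changes the first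
  element \<open>q\<^sub>1\<close> of \<open>C\<^sub>1\<close>. Undoing \<open>s\<^sub>2 \<cdots> s\<^sub>i\<close> turns this change into a change of the letters \<open>t\<close> of
  \<open>u\<close> at \<open>x\<^sub>t\<close> to \<open>t + 1\<close>, where \<open>x\<^sub>1 = q\<^sub>1\<close> and \<open>x\<^sub>t\<^sub>+\<^sub>1\<close> is the rightmost letter \<open>t + 1\<close> of \<open>u\<close> to the
  left of \<open>x\<^sub>t\<close>. While \<open>s\<^sub>1 \<cdots> s\<^sub>i\<^sub>-\<^sub>1\<close> is undone, the changes at \<open>x\<^sub>t\<close> cancel as long as
  \<open>x\<^sub>t = q\<^sub>t\<close>; after the last such \<open>t\<close>, which is the \<open>k\<close> of the theorem, each step replaces the change
  at \<open>x\<^sub>t\<close> by one at \<open>r\<^sub>t\<close> and lowers the letter at \<open>q\<^sub>t\<close>.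
\<close>

section \<open>Reflection of balanced brackets\<close>

text \<open>Integer valued, so that differences of counts, which serve as bracketing heights, are
  not truncated at 0.\<close>

definition cnt :: "nat set \<Rightarrow> nat \<Rightarrow> int" where
  "cnt S p = int (card (S \<inter> {..<p}))"

lemma cnt_0 [simp]: "cnt S 0 = 0"
  by (simp add: cnt_def)

lemma cnt_Suc: "cnt S (Suc p) = cnt S p + of_bool (p \<in> S)"
proof -
  have "S \<inter> {..<Suc p} = (if p \<in> S then insert p (S \<inter> {..<p}) else S \<inter> {..<p})"
    by (auto simp: less_Suc_eq)
  then show ?thesis by (simp add: cnt_def)
qed

lemma cnt_Un: "S \<inter> T = {} \<Longrightarrow> cnt (S \<union> T) p = cnt S p + cnt T p"
  unfolding cnt_def Int_Un_distrib2 by (subst card_Un_disjoint) auto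

lemma cnt_singleton [simp]: "cnt {x} p = of_bool (x < p)"
  by (simp add: cnt_def)

lemma cnt_insert: "x \<notin> S \<Longrightarrow> cnt (insert x S) p = cnt S p + of_bool (x < p)"
  using cnt_Un[of S "{x}" p] by simp

lemma cnt_Diff: "T \<subseteq> S \<Longrightarrow> cnt (S - T) p = cnt S p - cnt T p"
proof -
  assume "T \<subseteq> S"
  then have "cnt S p = cnt ((S - T) \<union> T) p" by (simp add: Un_absorb2)
  also have "\<dots> = cnt (S - T) p + cnt T p" by (rule cnt_Un) auto
  finally show ?thesis by simp
qed

lemma cnt_remove: "x \<in> S \<Longrightarrow> cnt (S - {x}) p = cnt S p - of_bool (x < p)"
  using cnt_Diff[of "{x}" S p] by simp

lemma cnt_mono: "p \<le> p' \<Longrightarrow> cnt S p \<le> cnt S p'"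
  by (auto simp: cnt_def intro!: card_mono)

lemma cnt_nonneg: "0 \<le> cnt S p"
  by (simp add: cnt_def)

lemma cnt_less_elem:
  assumes "cnt S p < cnt S p'"
  obtains x where "x \<in> S" "p \<le> x" "x < p'"
proof -
  have "\<not> S \<inter> {..<p'} \<subseteq> S \<inter> {..<p}"
    using assms card_mono[of "S \<inter> {..<p}" "S \<inter> {..<p'}"] by (auto simp: cnt_def)
  then obtain x where "x \<in> S" "x < p'" "\<not> x < p" by auto
  then show ?thesis using that by simp
qed

lemma cnt_pos_iff: "0 < cnt S p \<longleftrightarrow> (\<exists>x\<in>S. x < p)"
  by (auto simp: cnt_def card_gt_0_iff)

text \<open>\<open>A\<close> holds opening and \<open>B\<close> closing brackets, and
  \<open>cnt A p - cnt B p\<close> is the height just before \<open>p\<close>. The last condition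
  puts \<open>X\<close> at height zero, outside every pair.\<close>

definition balanced :: "nat set \<Rightarrow> nat set \<Rightarrow> nat set \<Rightarrow> nat \<Rightarrow> bool" where
  "balanced A B X n \<longleftrightarrow>
     A \<subseteq> {..<n} \<and> B \<subseteq> {..<n} \<and> X \<subseteq> {..<n} \<and>
     A \<inter> B = {} \<and> A \<inter> X = {} \<and> B \<inter> X = {} \<and>
     (\<forall>p. cnt B p \<le> cnt A p) \<and> cnt B n = cnt A n \<and> (\<forall>x\<in>X. cnt B x = cnt A x)"

lemma balanced_closer:
  assumes "balanced A B X n" "p \<in> B"
  shows "cnt B p < cnt A p"
proof -
  have "cnt B (Suc p) \<le> cnt A (Suc p)" "p \<notin> A"
    using assms by (auto simp: balanced_def)
  with assms(2) show ?thesis by (simp add: cnt_Suc)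
qed

text \<open>\<open>foldr\<close> reads the word from the right, and the unmatched closers
  \<open>cs\<close> of a suffix are counted by the height. Before an opener is added the height is
  positive, so a closer is there to be consumed. At a position of \<open>X\<close> the list
  \<open>cs\<close> is empty, and \<open>mono\<close> excludes pairs inside
  \<open>X\<close>.\<close>

lemma bracket_suffix:
  assumes bal: "balanced A B X n" and n: "length w = n"
    and A: "\<And>p. p < n \<Longrightarrow> p \<notin> X \<Longrightarrow> w ! p = j + 1 \<longleftrightarrow> p \<in> A"
    and B: "\<And>p. p < n \<Longrightarrow> p \<notin> X \<Longrightarrow> w ! p = j \<longleftrightarrow> p \<in> B"
    and X: "\<And>p. p \<in> X \<Longrightarrow> w ! p \<in> {j, j + 1}"
    and mono: "\<And>p q. p \<in> X \<Longrightarrow> q \<in> X \<Longrightarrow> p < q \<Longrightarrow> w ! p = j + 1 \<Longrightarrow> w ! q = j + 1"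
    and "p \<le> n"
  shows "\<exists>cs. foldr (push j w) (filter (\<lambda>p. w ! p \<in> {j, j + 1}) [p..<n]) []
      = cs @ filter (\<lambda>p. p \<in> X) [p..<n] \<and> (\<forall>c\<in>set cs. w ! c = j)
      \<and> int (length cs) = cnt A p - cnt B p"
  using \<open>p \<le> n\<close>
proof (induction rule: inc_induct)
  case base
  then show ?case using bal by (auto simp: balanced_def)
next
  case (step p)
  from step.IH obtain cs where
    cs: "foldr (push j w) (filter (\<lambda>p. w ! p \<in> {j, j + 1}) [Suc p..<n]) []
        = cs @ filter (\<lambda>p. p \<in> X) [Suc p..<n]" "\<forall>c\<in>set cs. w ! c = j"
      "int (length cs) = cnt A (Suc p) - cnt B (Suc p)"
    by blast
  have upt: "[p..<n] = p # [Suc p..<n]" using step.hyps by (simp add: upt_conv_Cons)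
  consider (X) "p \<in> X" | (A) "p \<notin> X" "p \<in> A" | (B) "p \<notin> X" "p \<in> B" | (N) "p \<notin> X \<union> A \<union> B"
    by blast
  then show ?case
  proof cases
    case X
    then have "p \<notin> A" "p \<notin> B" "cnt A p = cnt B p" using bal by (auto simp: balanced_def)
    with cs(3) have "cs = []" by (simp add: cnt_Suc)
    have *: "\<not> (w ! p = j + 1 \<and> w ! q = j)" if "q \<in> set (filter (\<lambda>p. p \<in> X) [Suc p..<n])" for q
      using that mono[OF X, of q] by auto
    have "push j w p (filter (\<lambda>p. p \<in> X) [Suc p..<n]) = p # filter (\<lambda>p. p \<in> X) [Suc p..<n]"
      using * by (cases "filter (\<lambda>p. p \<in> X) [Suc p..<n]") auto
    then show ?thesis using X assms(5)[OF X] cs \<open>cs = []\<close> \<open>cnt A p = cnt B p\<close>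
      by (intro exI[of _ "[]"]) (auto simp: upt)
  next
    case A
    then have "p \<notin> B" using bal by (auto simp: balanced_def)
    have "cnt B p \<le> cnt A p" using bal by (auto simp: balanced_def)
    with cs(3) A \<open>p \<notin> B\<close> obtain c cs' where "cs = c # cs'" by (cases cs) (auto simp: cnt_Suc)
    then show ?thesis using A cs \<open>p \<notin> B\<close> assms(3)[of p] step.hyps
      by (intro exI[of _ cs']) (auto simp: upt cnt_Suc)
  next
    case B
    then have "p \<notin> A" using bal by (auto simp: balanced_def)
    have "w ! p = j" using assms(4)[of p] B step.hyps by auto
    then have "push j w p zs = p # zs" for zs by (cases zs) auto
    then show ?thesis using B cs \<open>p \<notin> A\<close> \<open>w ! p = j\<close>
      by (intro exI[of _ "p # cs"]) (auto simp: upt cnt_Suc)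
  next
    case N
    then have "w ! p \<notin> {j, j + 1}" using assms(3,4)[of p] step.hyps by auto
    then show ?thesis using N cs
      by (intro exI[of _ cs]) (auto simp: upt cnt_Suc)
  qed
qed

lemma unpaired_balanced:
  assumes "balanced A B X n" and "length w = n"
    and "\<And>p. p < n \<Longrightarrow> p \<notin> X \<Longrightarrow> w ! p = j + 1 \<longleftrightarrow> p \<in> A"
    and "\<And>p. p < n \<Longrightarrow> p \<notin> X \<Longrightarrow> w ! p = j \<longleftrightarrow> p \<in> B"
    and "\<And>p. p \<in> X \<Longrightarrow> w ! p \<in> {j, j + 1}"
    and "\<And>p q. p \<in> X \<Longrightarrow> q \<in> X \<Longrightarrow> p < q \<Longrightarrow> w ! p = j + 1 \<Longrightarrow> w ! q = j + 1"
  shows "unpaired j w = filter (\<lambda>p. p \<in> X) [0..<n]"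
  using bracket_suffix[OF assms, where p = 0] assms(2) by (auto simp: unpaired_def bracket_positions_def)

section \<open>Strings of words and their reflection\<close>

lemma max_power_eqI:
  assumes "\<And>k. (g ^^ k) (Some b) \<noteq> None \<longleftrightarrow> k \<le> m"
  shows "max_power g b = m"
  unfolding max_power_def assms by (intro Max_eqI) auto

lemma string_powers:
  assumes e: "\<And>m. m \<le> N \<Longrightarrow> g (Some (W m)) = (if m < N then Some (W (Suc m)) else None)"
    and None: "g None = None"
  shows "(g ^^ k) (Some (W 0)) = (if k \<le> N then Some (W k) else None)"
  by (induction k) (auto simp: e None)

lemma f_op_None [simp]: "f_op j None = None" and e_op_None [simp]: "e_op j None = None"
  by (simp_all add: f_op_def e_op_def)

text \<open>\<open>f_op\<close> kills \<open>W 0\<close>, \<open>e_op\<close> kills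
  \<open>W N\<close>, and \<open>N\<close> steps separate them. So \<open>phi - eps\<close> is
  \<open>-N\<close> at one end and \<open>N\<close> at the other, and the reflection swaps the
  ends.\<close>

lemma s_op_string:
  assumes e: "\<And>m. m \<le> N \<Longrightarrow> e_op j (Some (W m)) = (if m < N then Some (W (Suc m)) else None)"
    and f: "\<And>m. m \<le> N \<Longrightarrow> f_op j (Some (W m)) = (if 0 < m then Some (W (m - 1)) else None)"
  shows "s_op j (Some (W 0)) = Some (W N)" and "s_op j (Some (W N)) = Some (W 0)"
proof -
  have e_pow: "(e_op j ^^ k) (Some (W 0)) = (if k \<le> N then Some (W k) else None)" for k
    by (rule string_powers) (use e in auto)
  have f_pow: "(f_op j ^^ k) (Some (W N)) = (if k \<le> N then Some (W (N - k)) else None)" for k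
    using string_powers[of N "f_op j" "\<lambda>m. W (N - m)" k] f by auto
  have e_pow_N: "(e_op j ^^ k) (Some (W N)) = (if k = 0 then Some (W N) else None)" for k
    by (induction k) (auto simp: e)
  have f_pow_0: "(f_op j ^^ k) (Some (W 0)) = (if k = 0 then Some (W 0) else None)" for k
    by (induction k) (auto simp: f)
  have "eps j (W 0) = N" "phi j (W 0) = 0" "eps j (W N) = 0" "phi j (W N) = N"
    by (rule max_power_eqI; simp add: e_pow f_pow e_pow_N f_pow_0)+
  then show "s_op j (Some (W 0)) = Some (W N)" "s_op j (Some (W N)) = Some (W 0)"
    by (auto simp: s_op_def e_pow f_pow)
qed

lemma s_op_balanced:
  assumes bal: "balanced A B X n"
    and len: "length w = n" "length w' = n"
    and A: "\<And>p. p < n \<Longrightarrow> w ! p = Suc j \<longleftrightarrow> p \<in> A"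
    and B: "\<And>p. p < n \<Longrightarrow> w ! p = j \<longleftrightarrow> p \<in> B \<union> X"
    and w': "\<And>p. p < n \<Longrightarrow> w' ! p = (if p \<in> X then Suc j else w ! p)"
  shows "s_op j (Some w) = Some w'" and "s_op j (Some w') = Some w"
proof -
  define xs where "xs = filter (\<lambda>p. p \<in> X) [0..<n]"
  define N where "N = length xs"
  \<comment> \<open>The string from \<open>w'\<close> to \<open>w\<close>: the first
    \<open>m\<close> positions of \<open>X\<close> carry \<open>j\<close>, the others
    \<open>j + 1\<close>. Thus \<open>W 0\<close> is \<open>w'\<close> and \<open>W N\<close> is
    \<open>w\<close>.\<close>
  define W where "W m = map (\<lambda>p. if p \<in> set (take m xs) then j
      else if p \<in> set (drop m xs) then j + 1 else w ! p) [0..<n]" for m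
  have set_xs: "set xs = X" using bal by (auto simp: xs_def balanced_def)
  have sorted: "sorted_wrt (<) xs" unfolding xs_def by (rule sorted_wrt_filter) simp
  have set_split: "set (take m xs) \<union> set (drop m xs) = X" for m
    using set_xs by (metis append_take_drop_id set_append)
  have take_lt_drop: "p < q" if "p \<in> set (take m xs)" "q \<in> set (drop m xs)" for p q m
    using sorted that by (metis append_take_drop_id sorted_wrt_append)
  have lenW: "length (W m) = n" for m by (simp add: W_def)
  have X_n: "p < n" if "p \<in> X" for p using that bal by (auto simp: balanced_def)
  have W_take: "W m ! p = j" if "p \<in> set (take m xs)" for m p
    using that X_n set_split[of m] by (auto simp: W_def)
  have W_drop: "W m ! p = j + 1" if "p \<in> set (drop m xs)" for m p
    using that X_n set_split[of m] take_lt_drop[of p m p] by (auto simp: W_def)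
  have W_else: "W m ! p = w ! p" if "p \<notin> X" "p < n" for m p
    using that set_split[of m] by (auto simp: W_def)
  \<comment> \<open>Along the string the letters on \<open>X\<close> increase weakly from left to
    right, so the unpaired positions never change.\<close>
  have unp: "unpaired j (W m) = xs" for m
    unfolding xs_def
  proof (rule unpaired_balanced[OF bal lenW])
    show "W m ! p = j + 1 \<longleftrightarrow> p \<in> A" if "p < n" "p \<notin> X" for p
      using that A W_else by auto
    show "W m ! p = j \<longleftrightarrow> p \<in> B" if "p < n" "p \<notin> X" for p
      using that B W_else by auto
    show "W m ! p \<in> {j, j + 1}" if "p \<in> X" for p
      using that set_split[of m] W_take W_drop by blast
    show "W m ! q = j + 1" if "p \<in> X" "q \<in> X" "p < q" "W m ! p = j + 1" for p q
    proof -
      have "p \<in> set (drop m xs)" using that W_take[of p m] set_split[of m] by auto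
      then have "q \<notin> set (take m xs)" using take_lt_drop[of q m p] that by auto
      then show ?thesis using that W_drop set_split[of m] by blast
    qed
  qed
  have filter_split: "filter P xs = filter P (take m xs) @ filter P (drop m xs)" for P m
    by (metis append_take_drop_id filter_append)
  have filter_1: "filter (\<lambda>p. W m ! p = j + 1) xs = drop m xs" for m
    unfolding filter_split[of _ m] using W_take[of _ m] W_drop[of _ m] by (simp add: filter_empty_conv)
  have filter_0: "filter (\<lambda>p. W m ! p = j) xs = take m xs" for m
    unfolding filter_split[of _ m] using W_take[of _ m] W_drop[of _ m] by (simp add: filter_empty_conv)
  have drop_Suc: "drop m xs = xs ! m # drop (Suc m) xs" if "m < N" for m
    using that by (simp add: N_def Cons_nth_drop_Suc)
  have take_Suc: "take (Suc m) xs = take m xs @ [xs ! m]" if "m < N" for m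
    using that by (simp add: N_def take_Suc_conv_app_nth)
  have set_take_Suc: "set (take (Suc m) xs) = insert (xs ! m) (set (take m xs))" if "m < N" for m
    using take_Suc[OF that] by simp
  have set_drop_Suc: "set (drop m xs) = insert (xs ! m) (set (drop (Suc m) xs))" if "m < N" for m
    using drop_Suc[OF that] by simp
  have upd_e: "(W m)[xs ! m := j] = W (Suc m)" if "m < N" for m
  proof (rule nth_equalityI)
    fix p assume "p < length ((W m)[xs ! m := j])"
    then have "p < n" by (simp add: lenW)
    then show "(W m)[xs ! m := j] ! p = W (Suc m) ! p"
      using set_take_Suc[OF that] set_drop_Suc[OF that]
      by (cases "p = xs ! m") (auto simp: W_def)
  qed (simp add: lenW)
  have upd_f: "(W (Suc m))[xs ! m := j + 1] = W m" if "m < N" for m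
  proof (rule nth_equalityI)
    fix p assume "p < length ((W (Suc m))[xs ! m := j + 1])"
    then have "p < n" by (simp add: lenW)
    then show "(W (Suc m))[xs ! m := j + 1] ! p = W m ! p"
      using set_take_Suc[OF that] set_drop_Suc[OF that] take_lt_drop[of "xs ! m" m "xs ! m"]
      by (cases "p = xs ! m") (auto simp: W_def)
  qed (simp add: lenW)
  have e: "e_op j (Some (W m)) = (if m < N then Some (W (Suc m)) else None)" if "m \<le> N" for m
    using upd_e[of m] drop_Suc[of m] that by (auto simp: e_op_def unp filter_1[simplified] N_def Let_def)
  have f: "f_op j (Some (W m)) = (if 0 < m then Some (W (m - 1)) else None)" if "m \<le> N" for m
    using upd_f[of "m - 1"] take_Suc[of "m - 1"] that
    by (auto simp: f_op_def unp filter_0 N_def Let_def)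
  have "W 0 = w'"
    using w' len set_xs by (intro nth_equalityI) (auto simp: W_def)
  moreover have "W N = w"
    using B len set_xs by (intro nth_equalityI) (auto simp: W_def N_def)
  ultimately show "s_op j (Some w) = Some w'" "s_op j (Some w') = Some w"
    using s_op_string[of N j W] e f by auto
qed

section \<open>Highest weight as dominance on suffixes\<close>

definition pos :: "word \<Rightarrow> nat \<Rightarrow> nat set" where
  "pos w t = {p. p < length w \<and> w ! p = t}"

definition dominates :: "nat \<Rightarrow> nat set \<Rightarrow> nat set \<Rightarrow> bool" where
  "dominates n P Q \<longleftrightarrow> (\<forall>p\<le>n. cnt Q n - cnt Q p \<le> cnt P n - cnt P p)"

text \<open>Only letters \<open>j\<close> are removed from the list, so an unmatched
  \<open>j + 1\<close> of a suffix survives to the end.\<close>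

lemma push_keeps:
  "q \<in> set zs \<Longrightarrow> w ! q = j + 1 \<Longrightarrow> q \<in> set (push j w p zs)"
  by (cases zs) auto


text \<open>The surplus of letters \<open>j\<close> over \<open>j + 1\<close> in a suffix equals
  that surplus among its unmatched letters. An unmatched \<open>j + 1\<close> would persist and be
  seen by \<open>e_op\<close>, so the surplus is nonnegative.\<close>

lemma dominates_of_e_op_None:
  assumes "e_op j (Some w) = None"
  shows "dominates (length w) (pos w j) (pos w (Suc j))"
proof -
  define n where "n = length w"
  define st where "st p = foldr (push j w) (filter (\<lambda>p. w ! p \<in> {j, j + 1}) [p..<n]) []" for p
  have st_rec: "st p = (if w ! p \<in> {j, j + 1} then push j w p (st (Suc p)) else st (Suc p))"
    if "p < n" for p
    using that by (simp add: st_def upt_conv_Cons)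
  have st0: "w ! q \<noteq> j + 1" if "q \<in> set (st 0)" for q
  proof -
    have "unpaired j w = st 0" by (simp add: unpaired_def bracket_positions_def st_def n_def)
    then have "filter (\<lambda>q. w ! q = j + 1) (st 0) = []"
      using assms unfolding e_op_def Let_def by (simp split: if_splits)
    then show ?thesis using that by (simp add: filter_empty_conv)
  qed
  have no_opener: "\<forall>q\<in>set (st p). w ! q \<noteq> j + 1" if "p \<le> n" for p
    using that
  proof (induction p)
    case (Suc p)
    have keeps: "q \<in> set (st p)" if "q \<in> set (st (Suc p))" "w ! q = j + 1" for q
    proof (cases "w ! p \<in> {j, j + 1}")
      case True
      then have "st p = push j w p (st (Suc p))" using st_rec[of p] Suc.prems by simp
      then show ?thesis using push_keeps[OF that] by metis
    next
      case False
      then have "st p = st (Suc p)" using st_rec[of p] Suc.prems by simp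
      then show ?thesis using that by metis
    qed
    have "\<forall>q\<in>set (st p). w ! q \<noteq> j + 1" using Suc.IH Suc.prems by (metis Suc_leD)
    with keeps show ?case by blast
  qed (use st0 in auto)
  have "cnt (pos w j) n - cnt (pos w j) p - (cnt (pos w (j + 1)) n - cnt (pos w (j + 1)) p)
     = int (length (filter (\<lambda>q. w ! q = j) (st p))) - int (length (filter (\<lambda>q. w ! q = j + 1) (st p)))"
    if "p \<le> n" for p
    using that
  proof (induction rule: inc_induct)
    case (step p)
    then show ?case
      using st_rec[OF step.hyps(2)]
      by (cases "st (Suc p)") (auto simp: cnt_Suc pos_def n_def)
  qed (simp add: st_def)
  moreover have "filter (\<lambda>q. w ! q = j + 1) (st p) = []" if "p \<le> n" for p
    using no_opener[OF that] by (simp add: filter_empty_conv)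
  ultimately show ?thesis
    by (force simp: dominates_def n_def[symmetric])
qed

section \<open>Chains of bracketed letters\<close>

lemma pos_subset: "pos w t \<subseteq> {..<length w}"
  by (auto simp: pos_def)

text \<open>The number of letters of \<open>A\<close> before \<open>p\<close> still unmatched when each letter of \<open>P\<close> takes one
  greedily; the truncated subtraction lets a letter of \<open>P\<close> stay unmatched.\<close>

primrec height :: "nat set \<Rightarrow> nat set \<Rightarrow> nat \<Rightarrow> nat" where
  "height A P 0 = 0"
| "height A P (Suc p) =
     (if p \<in> A then Suc (height A P p) else if p \<in> P then height A P p - 1 else height A P p)"

definition matched :: "nat set \<Rightarrow> nat set \<Rightarrow> nat set" where
  "matched A P = {p \<in> P. 0 < height A P p}"

lemma int_height: "A \<inter> P = {} \<Longrightarrow> int (height A P p) = cnt A p - cnt (matched A P) p"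
proof (induction p)
  case (Suc p)
  then have "\<not> (p \<in> A \<and> p \<in> P)" by blast
  with Suc show ?case by (auto simp: cnt_Suc matched_def)
qed simp

text \<open>The bound is the surplus of \<open>P\<close> over \<open>Q\<close> from \<open>p\<close>
  on. It rises together with the height at \<open>A\<close> and falls together with it at
  \<open>P\<close>; where the height is stuck at 0, dominance itself gives the bound. At
  \<open>p = n\<close> all of \<open>A\<close> is therefore matched.\<close>

lemma height_le:
  assumes dom: "dominates n P Q" and "A \<subseteq> Q" "Q \<inter> P = {}" and "p \<le> n"
  shows "int (height A P p) \<le> (cnt P n - cnt P p) - (cnt Q n - cnt Q p)"
  using \<open>p \<le> n\<close>
proof (induction p)
  case 0
  then show ?case using dom by (auto simp: dominates_def)
next
  case (Suc p)
  have "cnt Q n - cnt Q (Suc p) \<le> cnt P n - cnt P (Suc p)"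
    using dom Suc.prems by (auto simp: dominates_def)
  moreover have "\<not> (p \<in> Q \<and> p \<in> P)" "p \<in> A \<Longrightarrow> p \<in> Q" using assms by blast+
  ultimately show ?case using Suc by (cases "height A P p") (auto simp: cnt_Suc)
qed

lemma balanced_matched:
  assumes dom: "dominates n P Q" and "A \<subseteq> Q" "Q \<inter> P = {}" and "P \<subseteq> {..<n}" "Q \<subseteq> {..<n}"
  shows "balanced A (matched A P) (P - matched A P) n"
proof -
  have "A \<inter> P = {}" using assms by auto
  note h = int_height[OF this]
  have "cnt (matched A P) n = cnt A n"
    using height_le[OF assms(1-3), of n] h[of n] by simp
  moreover have "cnt (matched A P) p \<le> cnt A p" for p
    using h[of p] by linarith
  moreover have "cnt (matched A P) p = cnt A p" if "p \<in> P - matched A P" for p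
    using that h[of p] by (auto simp: matched_def)
  ultimately show ?thesis
    using assms unfolding balanced_def by (auto simp: matched_def)
qed

text \<open>From \<open>p\<close> on, \<open>R\<close> has as many elements as \<open>P\<close>
  minus the height at \<open>p\<close>. One bound is then \<open>height_le\<close>, the other says
  that heights are nonnegative.\<close>

lemma dominates_matched:
  assumes dom: "dominates n P Q" and "A \<subseteq> Q" "Q \<inter> P = {}" and "P \<subseteq> {..<n}" "Q \<subseteq> {..<n}"
    and "p \<le> n"
  defines "R \<equiv> A \<union> (P - matched A P)"
  shows "cnt Q n - cnt Q p \<le> cnt R n - cnt R p" and "cnt R n - cnt R p \<le> cnt P n - cnt P p"
proof -
  note bal = balanced_matched[OF assms(1-5)]
  have R: "cnt R p = cnt A p + cnt P p - cnt (matched A P) p" for p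
    using assms unfolding R_def
    by (subst cnt_Un) (auto simp: cnt_Diff matched_def)
  have h: "int (height A P p) = cnt A p - cnt (matched A P) p"
    using assms by (intro int_height) auto
  show "cnt Q n - cnt Q p \<le> cnt R n - cnt R p"
    using height_le[OF assms(1-3), of p] h bal \<open>p \<le> n\<close> by (auto simp: R balanced_def)
  show "cnt R n - cnt R p \<le> cnt P n - cnt P p"
    using h bal by (auto simp: R balanced_def)
qed

section \<open>Chains, and the words obtained by raising letters off a chain\<close>

text \<open>Indexed by the distance from the top letter \<open>m\<close>, so that the downward
  construction becomes a primitive recursion.\<close>

primrec links :: "word \<Rightarrow> nat \<Rightarrow> nat \<Rightarrow> nat set" where
  "links w m 0 = pos w m"
| "links w m (Suc d) = matched (links w m d) (pos w (m - Suc d))"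

definition chain :: "word \<Rightarrow> nat \<Rightarrow> nat \<Rightarrow> nat set" where
  "chain w m t = links w m (m - t)"

lemma chain_top: "chain w m m = pos w m"
  by (simp add: chain_def)

lemma chain_rec: "t < m \<Longrightarrow> chain w m t = matched (chain w m (Suc t)) (pos w t)"
proof -
  assume "t < m"
  then have "m - t = Suc (m - Suc t)" "m - Suc (m - Suc t) = t" by auto
  then show ?thesis by (simp add: chain_def)
qed

lemma chain_subset: "t \<le> m \<Longrightarrow> chain w m t \<subseteq> pos w t"
  by (cases "t = m") (auto simp: chain_top chain_rec matched_def)

text \<open>Under the dominance hypotheses below, this is what \<open>s_prod [j..<m]\<close> makes
  of \<open>w\<close>.\<close>

definition raise :: "word \<Rightarrow> nat \<Rightarrow> nat \<Rightarrow> word" where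
  "raise w m j = map (\<lambda>p. if j \<le> w ! p \<and> w ! p < m \<and> p \<notin> chain w m (w ! p)
     then Suc (w ! p) else w ! p) [0..<length w]"

lemma length_raise [simp]: "length (raise w m j) = length w"
  by (simp add: raise_def)

lemma nth_raise: "p < length w \<Longrightarrow> raise w m j ! p =
    (if j \<le> w ! p \<and> w ! p < m \<and> p \<notin> chain w m (w ! p) then Suc (w ! p) else w ! p)"
  by (simp add: raise_def)

lemma raise_top: "raise w m m = w"
  by (rule nth_equalityI) (auto simp: nth_raise)

lemma pos_disjoint: "s \<noteq> t \<Longrightarrow> pos w s \<inter> pos w t = {}"
  by (auto simp: pos_def)

lemma s_prod_None: "s_prod js None = None"
  by (induction js) (auto simp: s_prod_def s_op_def)

lemma s_prod_Cons: "s_prod (j # js) = s_op j \<circ> s_prod js"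
  by (simp add: s_prod_def)

context
  fixes w :: word and a m :: nat
  assumes dom: "\<And>t. a \<le> t \<Longrightarrow> t < m \<Longrightarrow> dominates (length w) (pos w t) (pos w (Suc t))"
begin

lemma chain_balanced:
  assumes "a \<le> t" "t < m"
  shows "balanced (chain w m (Suc t)) (chain w m t) (pos w t - chain w m t) (length w)"
  unfolding chain_rec[OF assms(2)]
  using assms pos_disjoint[of "Suc t" t w]
  by (intro balanced_matched[OF dom[OF assms] chain_subset _ pos_subset pos_subset]) auto

lemma pos_raise:
  assumes "a \<le> t" "t < m"
  shows "pos (raise w m a) (Suc t) = chain w m (Suc t) \<union> (pos w t - chain w m t)"
proof -
  have "p \<in> pos (raise w m a) (Suc t) \<longleftrightarrow> p \<in> chain w m (Suc t) \<union> (pos w t - chain w m t)"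
    if p: "p < length w" for p
  proof -
    have "p \<in> chain w m (Suc t) \<Longrightarrow> w ! p = Suc t"
      using chain_subset[of "Suc t" m w] assms by (auto simp: pos_def)
    moreover have "w ! p = Suc t \<Longrightarrow> \<not> Suc t < m \<Longrightarrow> p \<in> chain w m (Suc t)"
      using chain_top[of w m] assms p by (cases "Suc t = m") (auto simp: pos_def)
    ultimately show ?thesis
      using assms p by (cases "w ! p = t"; cases "w ! p = Suc t") (auto simp: pos_def nth_raise)
  qed
  moreover have "chain w m (Suc t) \<subseteq> {..<length w}"
    using chain_subset[of "Suc t" m w] pos_subset[of w "Suc t"] assms by auto
  ultimately show ?thesis
    by (auto simp: pos_def)
qed

text \<open>The old set \<open>pos w t\<close> separates the two new ones: by
  \<open>dominates_matched\<close> it dominates the new letters \<open>Suc t\<close> and is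
  dominated by the new letters \<open>t\<close>.\<close>

lemma dominates_raise:
  assumes "a < t" "t < m"
  shows "dominates (length w) (pos (raise w m a) t) (pos (raise w m a) (Suc t))"
proof -
  obtain s where s: "t = Suc s" using assms by (cases t) auto
  have *: "pos (raise w m a) (Suc t) = chain w m (Suc t) \<union> (pos w t - matched (chain w m (Suc t)) (pos w t))"
      "pos (raise w m a) t = chain w m t \<union> (pos w s - matched (chain w m t) (pos w s))"
    using assms by (auto simp: pos_raise s chain_rec)
  have 1: "dominates (length w) (pos w t) (pos w (Suc t))" "dominates (length w) (pos w s) (pos w t)"
    using dom[of t] dom[of s] assms by (auto simp: s)
  show ?thesis
    unfolding dominates_def
  proof (intro allI impI)
    fix p assume p: "p \<le> length w"
    show "cnt (pos (raise w m a) (Suc t)) (length w) - cnt (pos (raise w m a) (Suc t)) p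
        \<le> cnt (pos (raise w m a) t) (length w) - cnt (pos (raise w m a) t) p"
      unfolding *
      using dominates_matched(2)[OF 1(1) chain_subset _ pos_subset pos_subset p, of m]
        dominates_matched(1)[OF 1(2) chain_subset _ pos_subset pos_subset p, of m]
        pos_disjoint[of "Suc t" t w] pos_disjoint[of t s w] assms s
      by auto
  qed
qed

text \<open>The same separation at the top letter, where the letters \<open>Suc m\<close> have not
  moved.\<close>

lemma dominates_raise_top:
  assumes "a < m" and "dominates (length w) (pos w m) (pos w (Suc m))"
  shows "dominates (length w) (pos (raise w m a) m) (pos (raise w m a) (Suc m))"
proof -
  obtain s where s: "m = Suc s" using assms by (cases m) auto
  have *: "pos (raise w m a) m = chain w m m \<union> (pos w s - matched (chain w m m) (pos w s))"
    using pos_raise[of s] assms(1) s by (simp add: chain_rec)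
  have **: "pos (raise w m a) (Suc m) = pos w (Suc m)"
    by (auto simp: pos_def nth_raise split: if_splits)
  have 1: "dominates (length w) (pos w s) (pos w m)"
    using dom[of s] assms by (auto simp: s)
  show ?thesis
    unfolding dominates_def
  proof (intro allI impI)
    fix p assume p: "p \<le> length w"
    show "cnt (pos (raise w m a) (Suc m)) (length w) - cnt (pos (raise w m a) (Suc m)) p
        \<le> cnt (pos (raise w m a) m) (length w) - cnt (pos (raise w m a) m) p"
      unfolding * **
      using dominates_matched(1)[OF 1 chain_subset _ pos_subset pos_subset p, of m]
        pos_disjoint[of m s w] s order_trans[OF assms(2)[unfolded dominates_def, rule_format, OF p]]
      by auto
  qed
qed

text \<open>All letters \<open>Suc t\<close> off the chain have already been raised, so the openers
  are exactly the chain. The letters \<open>t\<close> off the chain then sit at height zero.\<close>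

lemma s_op_raise:
  assumes "a \<le> t" "t < m"
  shows "s_op t (Some (raise w m (Suc t))) = Some (raise w m t)"
proof (rule s_op_balanced(1)[OF chain_balanced[OF assms]])
  fix p assume p: "p < length w"
  have "p \<notin> chain w m t \<or> w ! p = t" "p \<notin> chain w m (Suc t) \<or> w ! p = Suc t"
    using chain_subset[of t m w] chain_subset[of "Suc t" m w] assms by (auto simp: pos_def)
  moreover have "\<not> Suc t < m \<Longrightarrow> w ! p = Suc t \<Longrightarrow> p \<in> chain w m (Suc t)"
    using p assms chain_top[of w m] by (cases "Suc t = m") (auto simp: pos_def)
  ultimately show "raise w m (Suc t) ! p = Suc t \<longleftrightarrow> p \<in> chain w m (Suc t)"
    and "raise w m (Suc t) ! p = t \<longleftrightarrow> p \<in> chain w m t \<union> (pos w t - chain w m t)"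
    and "raise w m t ! p = (if p \<in> pos w t - chain w m t then Suc t else raise w m (Suc t) ! p)"
    using p assms by (auto simp: nth_raise pos_def)
qed auto

lemma s_prod_raise:
  assumes "a \<le> m"
  shows "s_prod [a..<m] (Some w) = Some (raise w m a)"
proof -
  have "a \<le> j \<Longrightarrow> s_prod [j..<m] (Some w) = Some (raise w m j)" if "j \<le> m" for j
    using that
  proof (induction rule: inc_induct)
    case (step j)
    then show ?case by (simp add: upt_conv_Cons s_prod_Cons s_op_raise)
  qed (simp add: raise_top s_prod_def)
  with assms show ?thesis by blast
qed

end

lemma s_prod_rev_upt:
  assumes "\<And>j. a \<le> j \<Longrightarrow> j < m \<Longrightarrow> s_op j (Some (W j)) = Some (W (Suc j))"
    and "a \<le> m"
  shows "s_prod (rev [a..<m]) (Some (W a)) = Some (W m)"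
  using \<open>a \<le> m\<close> assms(1)
proof (induction rule: dec_induct)
  case (step j)
  then have "s_prod (rev [a..<j]) (Some (W a)) = Some (W j)" by simp
  with step.prems[of j] step.hyps show ?case by (simp add: s_prod_Cons)
qed (simp add: s_prod_def)

section \<open>The operator on a highest weight word\<close>

locale queer_highest_weight =
  fixes b :: word and i :: nat
  assumes i: "1 \<le> i"
    and hw: "highest_weight {1..i} b"
    and nonzero: "f_neg i (Some b) \<noteq> None"
begin

declare One_nat_def [simp del]

abbreviation "n \<equiv> length b"
abbreviation "N \<equiv> pos b"
abbreviation "C \<equiv> chain b i"

definition u :: word where
  "u = raise b i 1"

lemma length_u [simp]: "length u = n"
  by (simp add: u_def)

abbreviation "L \<equiv> pos u"
abbreviation "D \<equiv> chain u (Suc i)"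
abbreviation "v \<equiv> raise u (Suc i) 2"

definition q :: "nat \<Rightarrow> nat" where
  "q t = Min (C t)"

lemma dominates_letters: "1 \<le> t \<Longrightarrow> t \<le> i \<Longrightarrow> dominates n (N t) (N (Suc t))"
  using hw dominates_of_e_op_None[of t b] by (auto simp: highest_weight_def)

lemma C_balanced:
  assumes "1 \<le> t" "t < i"
  shows "balanced (C (Suc t)) (C t) (N t - C t) n"
  by (rule chain_balanced[where a = 1]) (use assms dominates_letters in auto)

lemma L_Suc:
  assumes "1 \<le> t" "t < i"
  shows "L (Suc t) = C (Suc t) \<union> (N t - C t)"
  unfolding u_def by (rule pos_raise) (use assms dominates_letters in auto)

lemma L_1: "L 1 = C 1"
proof -
  have "p \<in> L 1 \<longleftrightarrow> p \<in> C 1" if "p < n" for p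
  proof (cases "i = 1")
    case True
    have "u = b" using raise_top[of b i] unfolding u_def by (simp add: True)
    then show ?thesis using True chain_top[of b 1] by simp
  next
    case False
    then have "p \<in> L 1 \<longleftrightarrow> b ! p = 1 \<and> p \<in> C 1"
      using i that by (auto simp: u_def pos_def nth_raise)
    then show ?thesis
      using i chain_subset[of 1 i b] by (auto simp: pos_def)
  qed
  moreover have "C 1 \<subseteq> {..<n}" using chain_subset[of 1 i b] pos_subset[of b 1] i by auto
  ultimately show ?thesis by (auto simp: pos_def)
qed

lemma L_subset: "L t \<subseteq> {..<n}"
  using pos_subset[of u] by simp

text \<open>At \<open>t = i\<close> the letters \<open>i + 1\<close> of \<open>b\<close> enter; this
  is where highest weight for \<open>i\<close> itself is used.\<close>

lemma dominates_u:
  assumes "2 \<le> t" "t \<le> i"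
  shows "dominates n (L t) (L (Suc t))"
proof -
  have dom: "dominates n (N s) (N (Suc s))" if "1 \<le> s" "s < i" for s
    using that dominates_letters by simp
  show ?thesis
  proof (cases "t = i")
    case True
    show ?thesis
      unfolding u_def True
      by (rule dominates_raise_top[OF dom]) (use assms True dominates_letters in auto)
  next
    case False
    show ?thesis
      unfolding u_def by (rule dominates_raise[OF dom]) (use assms False in auto)
  qed
qed

lemma D_balanced:
  assumes "2 \<le> t" "t \<le> i"
  shows "balanced (D (Suc t)) (D t) (L t - D t) n"
  using chain_balanced[of 2 "Suc i" u t] dominates_u assms by simp

lemma forward: "(s_prod [2..<i + 1] \<circ> s_prod [1..<i]) (Some b) = Some v"
proof -
  have "s_prod [1..<i] (Some b) = Some u"
    unfolding u_def by (rule s_prod_raise) (use i dominates_letters in auto)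
  moreover have "s_prod [2..<i + 1] (Some u) = Some v"
    unfolding Suc_eq_plus1[symmetric]
    by (rule s_prod_raise) (use i dominates_u in auto)
  ultimately show ?thesis by simp
qed

lemma C_subset: "t \<le> i \<Longrightarrow> C t \<subseteq> N t"
  by (rule chain_subset)

lemma D_subset: "t \<le> Suc i \<Longrightarrow> D t \<subseteq> L t"
  by (rule chain_subset)

lemma C_less: "p \<in> C t \<Longrightarrow> t \<le> i \<Longrightarrow> p < n"
  using C_subset pos_subset by blast

lemma letter_C: "p \<in> C t \<Longrightarrow> t \<le> i \<Longrightarrow> b ! p = t"
  using C_subset[of t] by (auto simp: pos_def)

lemma finite_C: "t \<le> i \<Longrightarrow> finite (C t)"
  using C_less finite_subset[of "C t" "{..<n}"] by auto

lemma v_1: "p < n \<Longrightarrow> v ! p = 1 \<longleftrightarrow> p \<in> C 1"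
proof -
  assume p: "p < n"
  then have "v ! p = 1 \<longleftrightarrow> u ! p = 1" by (simp add: nth_raise)
  also have "\<dots> \<longleftrightarrow> p \<in> C 1" unfolding L_1[symmetric] using p by (simp add: pos_def)
  finally show ?thesis .
qed

lemma v_2:
  assumes "p < n"
  shows "v ! p = 2 \<longleftrightarrow> p \<in> D 2"
proof -
  have "v ! p = 2 \<longleftrightarrow> u ! p = 2 \<and> \<not> (2 < Suc i \<and> p \<notin> D 2)"
    using assms by (auto simp: nth_raise)
  also have "\<dots> \<longleftrightarrow> p \<in> D 2"
  proof (cases "i = 1")
    case True
    then have "D 2 = L 2" using chain_top[of u "Suc i"] by simp
    moreover have "p \<in> L 2 \<longleftrightarrow> u ! p = 2" using assms by (simp add: pos_def)
    moreover have "\<not> 2 < Suc i" using True by simp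
    ultimately show ?thesis by metis
  next
    case False
    then have "2 < Suc i" "p \<in> D 2 \<Longrightarrow> p \<in> L 2" using D_subset[of 2] i by auto
    moreover have "p \<in> L 2 \<longleftrightarrow> u ! p = 2" using assms by (simp add: pos_def)
    ultimately show ?thesis by metis
  qed
  finally show ?thesis .
qed

text \<open>\<open>None\<close> is absorbing, so \<open>f_neg_one\<close> does not kill
  \<open>v\<close>. Its first letter among 1 and 2 is hence a 1. As \<open>C 1\<close> and
  \<open>D 2\<close> carry the letters 1 and 2 of \<open>v\<close>, it is at \<open>q 1\<close>,
  left of all of \<open>D 2\<close>.\<close>

lemma f_neg_one_v: "C 1 \<noteq> {}" "\<forall>d\<in>D 2. q 1 < d" "f_neg_one (Some v) = Some (v[q 1 := 2])"
proof -
  define ps where "ps = filter (\<lambda>p. v ! p \<in> {1, 2}) [0..<n]"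
  have "f_neg_one (Some v) \<noteq> None"
  proof
    assume "f_neg_one (Some v) = None"
    then show False
      using nonzero forward by (simp add: f_neg_def s_prod_None)
  qed
  then have ps: "ps \<noteq> []" "v ! hd ps = 1" and f: "f_neg_one (Some v) = Some (v[hd ps := 2])"
    by (auto simp: f_neg_one_def Let_def ps_def split: if_splits)
  have set_ps: "set ps = C 1 \<union> D 2"
    using v_1 v_2 C_less[of _ 1] D_subset[of 2] L_subset[of 2] i by (auto simp: ps_def)
  have "hd ps \<in> set ps" using ps by simp
  then have "hd ps < n" by (auto simp: ps_def)
  with ps v_1 have hd: "hd ps \<in> C 1" by simp
  have "sorted_wrt (<) ps" unfolding ps_def by (rule sorted_wrt_filter) simp
  then have least: "hd ps < p" if "p \<in> set ps" "p \<noteq> hd ps" for p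
    using that by (cases ps) auto
  have q: "q 1 = hd ps"
    unfolding q_def using hd least set_ps finite_C[of 1] i
    by (intro Min_eqI) (auto simp: le_less)
  have "hd ps \<notin> D 2" using v_2[OF \<open>hd ps < n\<close>] ps by simp
  with q least set_ps show "\<forall>d\<in>D 2. q 1 < d" by force
  show "C 1 \<noteq> {}" "f_neg_one (Some v) = Some (v[q 1 := 2])" using hd f q by auto
qed

section \<open>The initial sequence consists of the first chain elements\<close>

lemma C_nonempty:
  assumes "1 \<le> t" "t \<le> i"
  shows "C t \<noteq> {}"
  using assms
proof (induction t rule: dec_induct)
  case base
  show ?case by (rule f_neg_one_v)
next
  case (step t)
  have "cnt (C (Suc t)) n = cnt (C t) n"
    using C_balanced[of t] step.hyps step.prems by (simp add: balanced_def)
  moreover have "0 < cnt (C t) n"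
    using step C_less[of _ t] by (force simp: cnt_pos_iff)
  ultimately have "0 < cnt (C (Suc t)) n" by simp
  then show ?case by (auto simp: cnt_pos_iff)
qed

lemma q_in: "1 \<le> t \<Longrightarrow> t \<le> i \<Longrightarrow> q t \<in> C t"
  unfolding q_def using C_nonempty finite_C by (intro Min_in) auto

lemma q_le: "t \<le> i \<Longrightarrow> p \<in> C t \<Longrightarrow> q t \<le> p"
  unfolding q_def using finite_C by simp

lemma C_diff:
  assumes "1 \<le> t" "t < i"
  shows "cnt (C t) p \<le> cnt (C (Suc t)) p"
    and "p \<in> C t \<Longrightarrow> cnt (C t) p < cnt (C (Suc t)) p"
    and "p \<in> N t \<Longrightarrow> p \<notin> C t \<Longrightarrow> cnt (C t) p = cnt (C (Suc t)) p"
  using C_balanced[OF assms] balanced_closer[OF C_balanced[OF assms], of p]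
  by (auto simp: balanced_def)

lemma cnt_C_0: "t \<le> i \<Longrightarrow> p \<le> q t \<Longrightarrow> cnt (C t) p = 0"
  using cnt_pos_iff[of "C t" p] q_le[of t] cnt_nonneg[of "C t" p] by force

lemma cnt_C_pos: "1 \<le> t \<Longrightarrow> t \<le> i \<Longrightarrow> q t < p \<Longrightarrow> 1 \<le> cnt (C t) p"
  using cnt_pos_iff[of "C t" p] q_in[of t] by force

lemma q_Suc_less:
  assumes "1 \<le> t" "t < i"
  shows "q (Suc t) < q t"
proof -
  have "0 < cnt (C (Suc t)) (q t)"
    using C_diff(2)[OF assms q_in] cnt_nonneg[of "C t" "q t"] assms by simp
  then show ?thesis using q_le[of "Suc t"] assms by (force simp: cnt_pos_iff)
qed

text \<open>A letter \<open>t\<close> strictly between would lie off the chain at height zero, yet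
  an opener and no closer has been read there.\<close>

lemma N_before_q:
  assumes "1 \<le> t" "t < i" "p \<in> N t" "q (Suc t) < p"
  shows "q t \<le> p"
proof (rule ccontr)
  assume "\<not> q t \<le> p"
  then have "p \<notin> C t" "cnt (C t) p = 0" using q_le[of t p] cnt_C_0[of t p] assms by auto
  then show False using C_diff(3)[of t p] cnt_C_pos[of "Suc t" p] assms by simp
qed

lemma q_less: "1 \<le> t \<Longrightarrow> t \<le> i \<Longrightarrow> q t < n"
  using q_in C_less by blast

lemma initial_seq_q: "initial_seq i b q"
  unfolding initial_seq_def
proof (intro conjI allI impI)
  fix p assume p: "p < q i"
  show "b ! p \<noteq> i"
    using p q_le[of i p] chain_top[of b i] q_less[of i] i by (auto simp: pos_def)
next
  fix t p assume t: "1 \<le> t \<and> t < i" and p: "q (t + 1) < p \<and> p < q t"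
  have "p < n" using p q_less[of t] t by simp
  moreover have "p \<notin> N t" using p N_before_q[of t p] t by (auto simp: not_le Suc_eq_plus1)
  ultimately show "b ! p \<noteq> t" by (simp add: pos_def)
next
  fix t assume "1 \<le> t \<and> t < i"
  then show "q (t + 1) < q t" "q t < n" "b ! q t = t"
    using q_Suc_less[of t] q_less[of t] letter_C[OF q_in, of t]
    by (auto simp: Suc_eq_plus1)
qed (use i q_less letter_C[OF q_in] in auto)

lemma initial_seq_unique:
  assumes "initial_seq i b q'" "1 \<le> t" "t \<le> i"
  shows "q' t = q t"
  using assms(3) assms(2)
proof (induction rule: inc_induct)
  case base
  then show ?case
    using assms(1) initial_seq_q unfolding initial_seq_def by (metis linorder_neqE_nat)
next
  case (step t)
  then have "q' (Suc t) = q (Suc t)" by simp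
  then show ?case
    using assms(1) initial_seq_q step.hyps step.prems unfolding initial_seq_def Suc_eq_plus1
    by (metis linorder_neqE_nat)
qed

section \<open>The path x of rightmost letters in u\<close>

primrec path :: "nat \<Rightarrow> nat" where
  "path 0 = q 1"
| "path (Suc d) = Max {p. p < path d \<and> p \<in> L (Suc (Suc d))}"

definition x :: "nat \<Rightarrow> nat" where
  "x t = path (t - 1)"

lemma x_1: "x 1 = q 1"
  by (simp add: x_def)

lemma x_Suc: "1 \<le> t \<Longrightarrow> x (Suc t) = Max {p. p < x t \<and> p \<in> L (Suc t)}"
  by (cases t) (simp_all add: x_def)

text \<open>With \<open>x t\<close> on the chain, \<open>q (Suc t)\<close> belongs to the set whose
  \<open>Max\<close> is taken, so that set is nonempty.\<close>

lemma x_next: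
  assumes "1 \<le> t" "t < i" "x t \<in> C t"
  shows "x (Suc t) < x t" and "x (Suc t) \<in> L (Suc t)"
    and "p \<in> L (Suc t) \<Longrightarrow> p < x t \<Longrightarrow> p \<le> x (Suc t)"
proof -
  let ?S = "{p. p < x t \<and> p \<in> L (Suc t)}"
  have fin: "finite ?S" by simp
  have "q (Suc t) < x t" using q_Suc_less q_le[of t "x t"] assms by force
  moreover have "q (Suc t) \<in> L (Suc t)" using q_in[of "Suc t"] L_Suc assms by auto
  ultimately have "?S \<noteq> {}" by blast
  then have "Max ?S \<in> ?S" using fin by (rule Max_in[rotated])
  then show "x (Suc t) < x t" "x (Suc t) \<in> L (Suc t)" unfolding x_Suc[OF assms(1)] by auto
  show "p \<le> x (Suc t)" if "p \<in> L (Suc t)" "p < x t"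
    unfolding x_Suc[OF assms(1)] using fin that by (intro Max_ge) auto
qed

text \<open>If \<open>x (Suc t)\<close> were off the chain, it would be a raised letter
  \<open>t\<close> at height zero. The height at \<open>x t\<close> is positive, so an element of
  \<open>C (Suc t)\<close> would lie between, against the choice of the rightmost letter.\<close>

lemma x_chain:
  assumes "1 \<le> t" "t \<le> i"
  shows "x t \<in> C t \<and> (t < i \<longrightarrow> x (Suc t) < x t \<and> x (Suc t) \<in> L (Suc t) \<and>
    (\<forall>p\<in>L (Suc t). p < x t \<longrightarrow> p \<le> x (Suc t)))"
  using assms
proof (induction t rule: dec_induct)
  case base
  have "x 1 \<in> C 1" using q_in[of 1] i by (simp add: x_1)
  then show ?case using x_next[of 1] by blast
next
  case (step t)
  then have IH: "x t \<in> C t" "x (Suc t) < x t" "x (Suc t) \<in> L (Suc t)"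
    "\<And>p. p \<in> L (Suc t) \<Longrightarrow> p < x t \<Longrightarrow> p \<le> x (Suc t)" by auto
  have "x (Suc t) \<in> C (Suc t)"
  proof (rule ccontr)
    assume "x (Suc t) \<notin> C (Suc t)"
    then have "x (Suc t) \<in> N t - C t" using IH L_Suc[of t] step.hyps step.prems by auto
    then have "cnt (C t) (x (Suc t)) = cnt (C (Suc t)) (x (Suc t))"
      using C_diff(3)[of t] step by auto
    moreover have "cnt (C t) (x (Suc t)) \<le> cnt (C t) (x t)"
      using IH by (intro cnt_mono) simp
    moreover have "cnt (C t) (x t) < cnt (C (Suc t)) (x t)"
      using C_diff(2)[of t] IH step by simp
    ultimately have "cnt (C (Suc t)) (x (Suc t)) < cnt (C (Suc t)) (x t)" by simp
    then obtain p where p: "p \<in> C (Suc t)" "x (Suc t) \<le> p" "p < x t"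
      by (rule cnt_less_elem)
    then have "p \<in> L (Suc t)" using L_Suc[of t] step by auto
    with p IH have "p = x (Suc t)" by force
    with p \<open>x (Suc t) \<notin> C (Suc t)\<close> show False by simp
  qed
  then show ?case using x_next[of "Suc t"] by auto
qed

lemma x_in: "1 \<le> t \<Longrightarrow> t \<le> i \<Longrightarrow> x t \<in> C t"
  using x_chain by blast

lemma x_Suc_less: "1 \<le> t \<Longrightarrow> t < i \<Longrightarrow> x (Suc t) < x t"
  using x_chain[of t] by simp

lemma x_rightmost: "1 \<le> t \<Longrightarrow> t < i \<Longrightarrow> p \<in> L (Suc t) \<Longrightarrow> p < x t \<Longrightarrow> p \<le> x (Suc t)"
  using x_chain[of t] by simp

lemma C_subset_L: "1 \<le> t \<Longrightarrow> t \<le> i \<Longrightarrow> C t \<subseteq> L t"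
  using L_1 L_Suc[of "t - 1"] by (cases "t = 1") auto

text \<open>By induction \<open>x (Suc t)\<close> is left of all of \<open>D (Suc t)\<close>, hence
  an unmatched letter at height zero. No closer precedes it, so no opener from
  \<open>D (Suc (Suc t))\<close> does either.\<close>

lemma x_less_D:
  assumes "1 \<le> t" "t \<le> i" "d \<in> D (Suc t)"
  shows "x t < d"
  using assms
proof (induction t arbitrary: d rule: dec_induct)
  case base
  then show ?case using f_neg_one_v(2) by (simp add: x_1)
next
  case (step t)
  have xL: "x (Suc t) \<in> L (Suc t)" using x_in[of "Suc t"] C_subset_L[of "Suc t"] step by auto
  have before: "x (Suc t) < x t" using x_Suc_less step by simp
  show ?case
  proof (rule ccontr)
    assume "\<not> x (Suc t) < d"
    moreover have "d \<noteq> x (Suc t)"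
      using xL D_subset[of "Suc (Suc t)"] step by (auto simp: pos_def)
    ultimately have "0 < cnt (D (Suc (Suc t))) (x (Suc t))"
      using step.prems unfolding cnt_pos_iff by (meson linorder_neqE_nat)
    moreover have "\<not> 0 < cnt (D (Suc t)) (x (Suc t))" "x (Suc t) \<notin> D (Suc t)"
      using step.IH before step.hyps step.prems unfolding cnt_pos_iff by force+
    moreover have "cnt (D (Suc t)) (x (Suc t)) = cnt (D (Suc (Suc t))) (x (Suc t))"
      using D_balanced[of "Suc t"] xL \<open>x (Suc t) \<notin> D (Suc t)\<close> step.hyps step.prems
      by (simp add: balanced_def)
    ultimately show False by simp
  qed
qed

section \<open>Undoing s_2, ..., s_i\<close>

text \<open>The modified word after \<open>s\<^sub>2, \<dots>, s\<^sub>j\<^sub>-\<^sub>1\<close> have been undone; the unmodified one is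
  \<open>raise u (Suc i) j\<close>.\<close>

definition down :: "nat \<Rightarrow> word" where
  "down j = map (\<lambda>p. let t = u ! p in
     if 1 \<le> t \<and> t < j \<and> p = x t then Suc t
     else if j \<le> t \<and> t \<le> i \<and> p \<notin> D t then Suc t
     else t) [0..<n]"

lemma length_down [simp]: "length (down j) = n"
  by (simp add: down_def)

lemma nth_down: "p < n \<Longrightarrow> down j ! p =
    (if 1 \<le> u ! p \<and> u ! p < j \<and> p = x (u ! p) then Suc (u ! p)
     else if j \<le> u ! p \<and> u ! p \<le> i \<and> p \<notin> D (u ! p) then Suc (u ! p)
     else u ! p)"
  by (simp add: down_def Let_def)

lemma u_x: "1 \<le> t \<Longrightarrow> t \<le> i \<Longrightarrow> u ! x t = t"
  using x_in[of t] C_subset_L[of t] by (auto simp: pos_def)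

lemma x_less: "1 \<le> t \<Longrightarrow> t \<le> i \<Longrightarrow> x t < n"
  using x_in C_less by blast

lemma down_2: "down 2 = v[q 1 := 2]"
proof (rule nth_equalityI)
  fix p assume "p < length (down 2)"
  then show "down 2 ! p = v[q 1 := 2] ! p"
  proof (cases "p = x 1")
    case True
    then show ?thesis using u_x[of 1] x_less[of 1] i by (simp add: nth_down x_1[symmetric])
  next
    case False
    have *: "1 \<le> t \<and> t < 2 \<longleftrightarrow> t = 1" for t :: nat by auto
    have "p < n" using \<open>p < length (down 2)\<close> by simp
    with False show ?thesis
      by (cases "u ! p = 1") (auto simp: nth_down nth_raise x_1[symmetric] *)
  qed
qed simp

lemma u_D: "p \<in> D t \<Longrightarrow> t \<le> Suc i \<Longrightarrow> u ! p = t"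
  using D_subset[of t] by (auto simp: pos_def)

text \<open>With \<open>s = j - 1\<close>, the changed letters at \<open>x j\<close> and
  \<open>x s\<close> form one extra bracket pair next to those of \<open>D\<close>. It encloses
  nothing of \<open>X\<close>, because \<open>x j\<close> is the rightmost letter \<open>j\<close>
  of \<open>u\<close> left of \<open>x s\<close>.\<close>

lemma s_op_down:
  assumes "2 \<le> j" "j \<le> i"
  shows "s_op j (Some (down j)) = Some (down (Suc j))"
proof -
  obtain s where s: "j = Suc s" using assms by (cases j) auto
  have s1: "1 \<le> s" "s < i" using assms s by auto
  define A where "A = insert (x j) (D (Suc j))"
  define B where "B = insert (x s) (D j)"
  define X where "X = L j - D j - {x j}"
  note bal = D_balanced[OF assms]
  have xj: "x j < x s" using x_Suc_less s s1 by simp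
  have ux: "u ! x j = j" "u ! x s = s" using u_x assms s by auto
  have xn: "x j < n" "x s < n" using x_less assms s by auto
  have xD: "x j \<notin> D j" "x s \<notin> D j" "x j \<notin> D (Suc j)"
    using x_less_D[of s] xj s s1 u_D[of "x j" "Suc j"] ux assms by force+
  have cA: "cnt A p = cnt (D (Suc j)) p + of_bool (x j < p)" for p
    unfolding A_def using xD by (simp add: cnt_insert)
  have cB: "cnt B p = cnt (D j) p + of_bool (x s < p)" for p
    unfolding B_def using xD by (simp add: cnt_insert)
  have "balanced A B X n"
    unfolding balanced_def
  proof (intro conjI allI ballI)
    show "A \<subseteq> {..<n}" "B \<subseteq> {..<n}" "X \<subseteq> {..<n}"
      using bal xn unfolding balanced_def A_def B_def X_def by auto
    show "A \<inter> B = {}" using bal xD xj u_D[of "x s" "Suc j"] ux s assms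
      unfolding balanced_def A_def B_def by auto
    show "A \<inter> X = {}" using bal unfolding balanced_def A_def X_def by auto
    show "B \<inter> X = {}" using ux s unfolding B_def X_def by (auto simp: pos_def)
    have "cnt (D j) p \<le> cnt (D (Suc j)) p" for p using bal by (simp add: balanced_def)
    then show "cnt B p \<le> cnt A p" for p
      using xj unfolding cA cB by (intro add_mono) auto
    show "cnt B n = cnt A n" using bal xn unfolding cA cB balanced_def by simp
    show "cnt B p = cnt A p" if "p \<in> X" for p
    proof -
      have "p \<in> L (Suc s)" "p \<noteq> x j" using that s by (auto simp: X_def)
      moreover have "p \<noteq> x s" using that ux s by (auto simp: X_def pos_def)
      ultimately have "x j < p \<longleftrightarrow> x s < p"
        using x_rightmost[of s p] s1 xj s by (cases "p < x s") auto
      moreover have "cnt (D j) p = cnt (D (Suc j)) p"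
        using that bal by (auto simp: balanced_def X_def)
      ultimately show ?thesis by (simp add: cA cB)
    qed
  qed
  then show ?thesis
  proof (rule s_op_balanced(2))
    fix p assume p: "p < n"
    have D_top: "p \<in> D (Suc j)" if "u ! p = Suc j" "\<not> Suc j \<le> i"
    proof -
      have "j = i" using that assms by simp
      then show ?thesis using that p chain_top[of u "Suc i"] by (simp add: pos_def)
    qed
    define t where "t = u ! p"
    have at: "down (Suc j) ! p = (if 1 \<le> t \<and> t < Suc j \<and> p = x t then Suc t
         else if Suc j \<le> t \<and> t \<le> i \<and> p \<notin> D t then Suc t else t)"
      "down j ! p = (if 1 \<le> t \<and> t < j \<and> p = x t then Suc t
         else if j \<le> t \<and> t \<le> i \<and> p \<notin> D t then Suc t else t)"
      using p by (simp_all add: nth_down t_def)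
    have mem: "p \<in> D j \<Longrightarrow> t = j" "p \<in> D (Suc j) \<Longrightarrow> t = Suc j" "p \<in> L j \<longleftrightarrow> t = j"
      "p = x j \<Longrightarrow> t = j" "p = x s \<Longrightarrow> t = s" "t = Suc j \<Longrightarrow> \<not> Suc j \<le> i \<Longrightarrow> p \<in> D (Suc j)"
      using u_D[of p j] u_D[of p "Suc j"] ux assms p D_top
      by (auto simp: t_def pos_def)
    have "down (Suc j) ! p = Suc j \<longleftrightarrow> p = x j \<or> p \<in> D (Suc j)"
      unfolding at using mem assms s1 s by (cases "t = j"; cases "t = Suc j") auto
    then show "down (Suc j) ! p = Suc j \<longleftrightarrow> p \<in> A" by (simp add: A_def)
    have "down (Suc j) ! p = j \<longleftrightarrow> p = x s \<or> (t = j \<and> p \<noteq> x j)"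
      unfolding at using mem assms s1 s by (cases "t = j"; cases "t = s") auto
    then show "down (Suc j) ! p = j \<longleftrightarrow> p \<in> B \<union> X"
      using mem xD by (auto simp: B_def X_def)
    have "down j ! p = (if t = j \<and> p \<notin> D j \<and> p \<noteq> x j then Suc j else down (Suc j) ! p)"
      unfolding at using mem assms s1 s xD by (cases "t = j"; cases "t = s") auto
    then show "down j ! p = (if p \<in> X then Suc j else down (Suc j) ! p)"
      using mem by (simp add: X_def)
  qed simp_all
qed

lemma down_top:
  "s_prod (rev [2..<i + 1]) (Some (v[q 1 := 2])) = Some (down (Suc i))"
  unfolding down_2[symmetric] Suc_eq_plus1[symmetric]
  by (rule s_prod_rev_upt) (use s_op_down i in auto)

text \<open>Defined through \<open>x\<close>, which governs the words; \<open>Max_eq_k\<close>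
  identifies it with the index given by \<open>q\<close> and \<open>r\<close>.\<close>

definition k :: nat where
  "k = Max {t \<in> {1..i}. x t = q t}"

lemma q_le_x: "1 \<le> t \<Longrightarrow> t \<le> i \<Longrightarrow> q t \<le> x t"
  by (rule q_le[OF _ x_in])

lemma k_props: "1 \<le> k" "k \<le> i" "x k = q k"
  and k_greatest: "k < t \<Longrightarrow> t \<le> i \<Longrightarrow> q t < x t"
proof -
  let ?K = "{t \<in> {1..i}. x t = q t}"
  have "1 \<in> ?K" using i x_1 by simp
  then have "k \<in> ?K" unfolding k_def by (intro Max_in) auto
  then show k: "1 \<le> k" "k \<le> i" "x k = q k" by auto
  show "q t < x t" if "k < t" "t \<le> i"
  proof -
    have "t \<notin> ?K"
    proof
      assume "t \<in> ?K"
      then have "t \<le> k" unfolding k_def by (intro Max_ge) auto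
      with that show False by simp
    qed
    with that k q_le_x[of t] show ?thesis by force
  qed
qed

text \<open>Chain elements are letters of \<open>u\<close>, and \<open>x (Suc t)\<close> is the
  rightmost letter \<open>Suc t\<close> of \<open>u\<close> left of \<open>x t\<close>; so the count
  is constant in between.\<close>

lemma cnt_C_x:
  assumes "1 \<le> t" "t < i" "x (Suc t) < p" "p \<le> x t"
  shows "cnt (C (Suc t)) p = cnt (C (Suc t)) (x (Suc t)) + 1"
proof -
  have "cnt (C (Suc t)) p = cnt (C (Suc t)) (Suc (x (Suc t)))"
  proof (rule ccontr)
    assume "cnt (C (Suc t)) p \<noteq> cnt (C (Suc t)) (Suc (x (Suc t)))"
    moreover have "cnt (C (Suc t)) (Suc (x (Suc t))) \<le> cnt (C (Suc t)) p"
      using assms by (intro cnt_mono) simp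
    ultimately have "cnt (C (Suc t)) (Suc (x (Suc t))) < cnt (C (Suc t)) p" by simp
    then obtain y where "y \<in> C (Suc t)" "Suc (x (Suc t)) \<le> y" "y < p" by (rule cnt_less_elem)
    then show False using x_rightmost[of t y] C_subset_L[of "Suc t"] assms by auto
  qed
  then show ?thesis using x_in[of "Suc t"] assms by (simp add: cnt_Suc)
qed

text \<open>Otherwise only one element of \<open>C (Suc t)\<close> precedes \<open>x t\<close>,
  while \<open>x t\<close>, not being first in \<open>C t\<close>, needs two. Hence the path never
  returns to \<open>q\<close> after leaving it.\<close>

lemma x_Suc_neq_q:
  assumes "1 \<le> t" "t < i" "x t \<noteq> q t"
  shows "x (Suc t) \<noteq> q (Suc t)"
proof
  assume eq: "x (Suc t) = q (Suc t)"
  have "q t < x t" using q_le_x[of t] assms by simp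
  then have "1 \<le> cnt (C t) (x t)" using cnt_C_pos assms by simp
  also have "\<dots> < cnt (C (Suc t)) (x t)" using C_diff(2)[OF _ _ x_in] assms by simp
  also have "\<dots> = 1"
    using cnt_C_x[of t "x t"] x_Suc_less[of t] cnt_C_0[of "Suc t" "q (Suc t)"] assms eq by simp
  finally show False by simp
qed

lemma x_eq_q:
  assumes "1 \<le> t" "t \<le> k"
  shows "x t = q t"
  using assms(2) assms(1)
proof (induction rule: inc_induct)
  case base
  show ?case by (rule k_props)
next
  case (step t)
  then show ?case using x_Suc_neq_q[of t] k_props(2) by (cases "x t = q t") auto
qed

lemma cnt_C_Suc_q: "1 \<le> t \<Longrightarrow> t \<le> i \<Longrightarrow> cnt (C t) (Suc (q t)) = 1"
  using cnt_C_0[of t "q t"] q_in[of t] by (simp add: cnt_Suc)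

section \<open>Comparison with the leftward sequence r\<close>

context
  fixes r :: "nat \<Rightarrow> nat"
  assumes r: "leftward_seq i b (q 1) r"
begin

lemma r_1: "r 1 = q 1"
  using r by (simp add: leftward_seq_def)

lemma r_Suc:
  assumes "1 \<le> t" "t < i"
  shows "r (Suc t) < r t" and "b ! r (Suc t) = Suc t"
    and "p \<in> N (Suc t) \<Longrightarrow> p < r t \<Longrightarrow> p \<le> r (Suc t)"
proof -
  have "r (Suc t) < r (Suc t - 1) \<and> b ! r (Suc t) = Suc t \<and>
      (\<forall>p. r (Suc t) < p \<and> p < r (Suc t - 1) \<longrightarrow> b ! p \<noteq> Suc t)"
    using r assms unfolding leftward_seq_def by (metis Suc_le_eq less_Suc_eq_le)
  then show "r (Suc t) < r t" "b ! r (Suc t) = Suc t"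
      "p \<in> N (Suc t) \<Longrightarrow> p < r t \<Longrightarrow> p \<le> r (Suc t)"
    by (auto simp: pos_def not_less[symmetric])
qed

lemma r_N: "1 \<le> t \<Longrightarrow> t \<le> i \<Longrightarrow> r t \<in> N t"
proof (induction t rule: dec_induct)
  case base
  then show ?case using q_in[of 1] C_subset[of 1] i r_1 by auto
next
  case (step t)
  then show ?case using r_Suc(1,2)[of t] by (auto simp: pos_def)
qed

lemma x_le_r: "1 \<le> t \<Longrightarrow> t \<le> i \<Longrightarrow> x t \<le> r t"
proof (induction t rule: dec_induct)
  case base
  then show ?case by (simp add: r_1 x_1)
next
  case (step t)
  then have "x (Suc t) < r t" using x_Suc_less[of t] by simp
  moreover have "x (Suc t) \<in> N (Suc t)"
    using x_in[of "Suc t"] C_subset[of "Suc t"] step by auto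
  ultimately show ?case using r_Suc(3)[of t] step by simp
qed

lemma r_C_eq_q:
  assumes "1 \<le> t" "t \<le> i" "cnt (C t) (Suc (r t)) = 1" "r t \<in> C t"
  shows "r t = q t"
proof (rule ccontr)
  assume "r t \<noteq> q t"
  then have "1 \<le> cnt (C t) (r t)" using q_le[of t "r t"] assms by (intro cnt_C_pos) auto
  with assms show False by (simp add: cnt_Suc)
qed

text \<open>If \<open>r t\<close> is on the chain, it is \<open>q t = x t\<close>, and only
  \<open>q (Suc t)\<close> of \<open>C (Suc t)\<close> precedes it. If not, it is at height zero and
  the count passes from \<open>C t\<close> to \<open>C (Suc t)\<close>.\<close>

lemma cnt_C_r: "1 \<le> t \<Longrightarrow> t \<le> k \<Longrightarrow> cnt (C t) (Suc (r t)) = 1"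
proof (induction t rule: dec_induct)
  case base
  then show ?case using cnt_C_Suc_q[of 1] i by (simp add: r_1)
next
  case (step t)
  have t: "1 \<le> t" "t < i" "t < k" using step k_props by auto
  have IH: "cnt (C t) (Suc (r t)) = 1" using step by simp
  have "cnt (C (Suc t)) (r t) \<le> 1"
  proof (cases "r t \<in> C t")
    case True
    then have "r t = q t" using r_C_eq_q[of t] IH t by simp
    then have "r t = x t" using x_eq_q[of t] t by simp
    moreover have "x (Suc t) = q (Suc t)" using x_eq_q t by simp
    ultimately show ?thesis
      using cnt_C_x[of t "x t"] x_Suc_less[of t] cnt_C_0[of "Suc t" "q (Suc t)"] t by simp
  next
    case False
    then have "cnt (C (Suc t)) (r t) = cnt (C t) (r t)" using C_diff(3)[of t "r t"] r_N[of t] t by simp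
    then show ?thesis using IH False by (simp add: cnt_Suc)
  qed
  moreover have "cnt (C (Suc t)) (Suc (r (Suc t))) \<le> cnt (C (Suc t)) (r t)"
    using r_Suc(1)[of t] t by (intro cnt_mono) simp
  moreover have "1 \<le> cnt (C (Suc t)) (Suc (r (Suc t)))"
    using q_le_x[of "Suc t"] x_le_r[of "Suc t"] t by (intro cnt_C_pos) auto
  ultimately show ?case by simp
qed

text \<open>If \<open>r k\<close> were off the chain, height zero would leave one element of
  \<open>C (Suc k)\<close> before it. That element is \<open>x (Suc k)\<close>, but
  \<open>q (Suc k)\<close> comes strictly earlier by the choice of \<open>k\<close>.\<close>

lemma r_k: "r k = q k"
proof -
  note k = k_props
  have "r k \<in> C k"
  proof (rule ccontr)
    assume rk: "r k \<notin> C k"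
    have "k \<noteq> i" using rk r_N[of i] chain_top[of b i] i by auto
    then have ki: "k < i" using k by simp
    have "cnt (C (Suc k)) (x k) \<le> cnt (C (Suc k)) (r k)"
      using x_le_r[of k] k by (intro cnt_mono) simp
    also have "\<dots> = cnt (C k) (r k)" using C_diff(3)[of k "r k"] r_N[of k] rk k ki by simp
    also have "\<dots> = 1" using cnt_C_r[of k] rk k by (simp add: cnt_Suc)
    finally have "cnt (C (Suc k)) (x (Suc k)) \<le> 0"
      using cnt_C_x[of k "x k"] x_Suc_less[of k] ki k by simp
    moreover have "1 \<le> cnt (C (Suc k)) (x (Suc k))"
      using k_greatest[of "Suc k"] ki by (intro cnt_C_pos) auto
    ultimately show False by simp
  qed
  then show ?thesis using r_C_eq_q[of k] cnt_C_r[of k] k by simp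
qed

lemma Max_eq_k: "Max {t \<in> {1..i}. q t = r t} = k"
proof (rule Max_eqI)
  show "t \<le> k" if "t \<in> {t \<in> {1..i}. q t = r t}" for t
    using that k_greatest[of t] x_le_r[of t] by (cases "t \<le> k") auto
  show "k \<in> {t \<in> {1..i}. q t = r t}" using k_props r_k by simp
qed simp

text \<open>A chain element \<open>p\<close> in the gap at \<open>Suc t\<close> lies between
  \<open>x t\<close> and \<open>r t\<close>. By induction \<open>r t\<close> is off the chain, at
  height zero, so a closer from \<open>C t\<close> must follow \<open>p\<close> before
  \<open>r t\<close>, against the induction hypothesis.\<close>

lemma no_C_between:
  assumes "k \<le> t" "t \<le> i" "p \<in> C t" "p \<le> r t"
  shows "p \<le> x t"
  using assms
proof (induction t arbitrary: p rule: dec_induct)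
  case base
  then show ?case using r_k k_props by simp
next
  case (step t)
  have t: "1 \<le> t" "t < i" using step.hyps step.prems k_props by auto
  show ?case
  proof (rule ccontr)
    assume *: "\<not> p \<le> x (Suc t)"
    have "p \<in> L (Suc t)" using C_subset_L[of "Suc t"] step.prems by auto
    then have "\<not> p < x t" using x_rightmost[of t p] t * by auto
    moreover have "p \<noteq> x t" using step.prems letter_C[of p "Suc t"] letter_C[OF x_in, of t] t by auto
    ultimately have xp: "x t < p" by simp
    have pr: "p < r t" using r_Suc(1)[of t] t step.prems by simp
    have "r t \<notin> C t" using step.IH[of "r t"] xp pr t by auto
    then have "cnt (C t) (r t) = cnt (C (Suc t)) (r t)"
      using C_diff(3)[of t "r t"] r_N[of t] t by simp
    moreover have "cnt (C (Suc t)) (Suc p) \<le> cnt (C (Suc t)) (r t)"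
      using pr by (intro cnt_mono) simp
    moreover have "cnt (C t) p \<le> cnt (C (Suc t)) p" using C_diff(1) t by simp
    ultimately have "cnt (C t) p < cnt (C t) (r t)" using step.prems by (simp add: cnt_Suc)
    then obtain y where "y \<in> C t" "p \<le> y" "y < r t" by (rule cnt_less_elem)
    then show False using step.IH[of y] xp t by auto
  qed
qed

text \<open>The modified word after \<open>s\<^sub>1, \<dots>, s\<^sub>j\<^sub>-\<^sub>1\<close> have been undone; the unmodified one is \<open>raise b i j\<close>.\<close>

definition up :: "nat \<Rightarrow> word" where
  "up j = map (\<lambda>p. let t = b ! p in
     if k < t \<and> t \<le> j \<and> p = q t then t - 1
     else if k \<le> t \<and> t < j \<and> p = r t then Suc t
     else if j \<le> t \<and> t \<le> i \<and> p = x t then Suc t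
     else if j \<le> t \<and> t < i \<and> p \<notin> C t then Suc t
     else t) [0..<n]"

lemma length_up [simp]: "length (up j) = n"
  by (simp add: up_def)

lemma nth_up: "p < n \<Longrightarrow> b ! p = t \<Longrightarrow> up j ! p =
    (if k < t \<and> t \<le> j \<and> p = q t then t - 1
     else if k \<le> t \<and> t < j \<and> p = r t then Suc t
     else if j \<le> t \<and> t \<le> i \<and> p = x t then Suc t
     else if j \<le> t \<and> t < i \<and> p \<notin> C t then Suc t
     else t)"
proof -
  assume p: "p < n" and t: "b ! p = t"
  then have "[0..<n] ! p = p" "p < length [0..<n]" by simp_all
  then show ?thesis by (simp only: up_def Let_def nth_map t)
qed

lemma b_x: "1 \<le> t \<Longrightarrow> t \<le> i \<Longrightarrow> b ! x t = t"
  using letter_C[OF x_in] by simp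

lemma b_q: "1 \<le> t \<Longrightarrow> t \<le> i \<Longrightarrow> b ! q t = t"
  using letter_C[OF q_in] by simp

lemma b_r: "1 \<le> t \<Longrightarrow> t \<le> i \<Longrightarrow> b ! r t = t"
  using r_N by (simp add: pos_def)

text \<open>The positions \<open>x t\<close> are on the chain, so their letters agree in
  \<open>b\<close> and \<open>u\<close>; elsewhere \<open>up 1\<close> is just
  \<open>u\<close>.\<close>

lemma up_1: "up 1 = down (Suc i)"
proof (rule nth_equalityI)
  fix p assume "p < length (up 1)"
  then have p: "p < n" by simp
  define t where "t = b ! p"
  have t: "b ! p = t" by (simp add: t_def)
  have k: "\<not> (k < t \<and> t \<le> 1 \<and> P)" "\<not> (k \<le> t \<and> t < 1 \<and> P)" for P using k_props by auto
  have up: "up 1 ! p = (if 1 \<le> t \<and> t \<le> i \<and> p = x t then Suc t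
     else if 1 \<le> t \<and> t < i \<and> p \<notin> C t then Suc t else t)"
    by (simp only: nth_up[OF p t] k if_False)
  have down: "down (Suc i) ! p = (if 1 \<le> u ! p \<and> u ! p \<le> i \<and> p = x (u ! p) then Suc (u ! p) else u ! p)"
    using p by (auto simp: nth_down)
  have up_u: "u ! p = (if 1 \<le> t \<and> t < i \<and> p \<notin> C t then Suc t else t)"
    using p t by (simp add: u_def nth_raise)
  show "up 1 ! p = down (Suc i) ! p"
  proof (cases "1 \<le> t \<and> t \<le> i \<and> p = x t")
    case True
    then have "p \<in> C t" "u ! p = t" using x_in[of t] u_x[of t] by auto
    then show ?thesis using True unfolding up down by auto
  next
    case False
    have "\<not> (1 \<le> u ! p \<and> u ! p \<le> i \<and> p = x (u ! p))"
    proof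
      assume *: "1 \<le> u ! p \<and> u ! p \<le> i \<and> p = x (u ! p)"
      then have "b ! p = u ! p" using b_x[of "u ! p"] by simp
      with * False t show False by simp
    qed
    then have "down (Suc i) ! p = u ! p" by (simp only: down if_False)
    moreover have "up 1 ! p = u ! p" unfolding up up_u using False by (simp only: if_False)
    ultimately show ?thesis by simp
  qed
qed simp

lemma C_letters:
  assumes "1 \<le> j" "j < i" "p < n" "b ! p = t"
  shows "p \<in> C j \<Longrightarrow> t = j" "p \<in> C (Suc j) \<Longrightarrow> t = Suc j" "p \<in> N j \<longleftrightarrow> t = j"
    "t = Suc j \<Longrightarrow> \<not> Suc j < i \<Longrightarrow> p \<in> C (Suc j)"
proof -
  show "p \<in> C j \<Longrightarrow> t = j" "p \<in> C (Suc j) \<Longrightarrow> t = Suc j" "p \<in> N j \<longleftrightarrow> t = j"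
    using assms letter_C[of p j] letter_C[of p "Suc j"] by (auto simp: pos_def)
  show "p \<in> C (Suc j)" if "t = Suc j" "\<not> Suc j < i"
  proof -
    have "Suc j = i" using that assms by simp
    then have "C (Suc j) = N (Suc j)" using chain_top[of b i] by simp
    then show ?thesis using assms that by (simp add: pos_def)
  qed
qed

text \<open>Here \<open>x\<close> and \<open>q\<close> agree at \<open>j\<close> and
  \<open>Suc j\<close>. The raised \<open>q (Suc j)\<close> is no longer an opener, which leaves
  \<open>q j\<close> at height zero; \<open>s_op j\<close> lowers it, cancelling the change
  there.\<close>

lemma s_op_up_low:
  assumes "1 \<le> j" "j < i" "j < k"
  shows "s_op j (Some (up j)) = Some (up (Suc j))"
proof -
  define A where "A = C (Suc j) - {q (Suc j)}"
  define B where "B = C j - {q j}"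
  define X where "X = insert (q j) (N j - C j)"
  have xq: "x j = q j" "x (Suc j) = q (Suc j)" using x_eq_q assms by auto
  have qj: "q j \<in> C j" "q (Suc j) \<in> C (Suc j)" "q (Suc j) < q j" "q j < n"
    using q_in q_Suc_less q_less assms by auto
  have bq: "b ! q j = j" "b ! q (Suc j) = Suc j" using b_q assms by auto
  have cA: "cnt A p = cnt (C (Suc j)) p - of_bool (q (Suc j) < p)" for p
    unfolding A_def using qj by (simp add: cnt_remove)
  have cB: "cnt B p = cnt (C j) p - of_bool (q j < p)" for p
    unfolding B_def using qj by (simp add: cnt_remove)
  note bal = C_balanced[OF assms(1,2)]
  have "balanced A B X n"
    unfolding balanced_def
  proof (intro conjI allI ballI)
    show "A \<subseteq> {..<n}" "B \<subseteq> {..<n}" "X \<subseteq> {..<n}" "A \<inter> B = {}" "A \<inter> X = {}" "B \<inter> X = {}"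
      using bal qj unfolding balanced_def A_def B_def X_def by auto
    show "cnt B p \<le> cnt A p" for p
      using C_diff(1)[OF assms(1,2), of p] cnt_C_0[of j p] cnt_C_pos[of "Suc j" p] qj assms
        cnt_nonneg[of "C (Suc j)" p]
      unfolding cA cB by (cases "q j < p"; cases "q (Suc j) < p") auto
    show "cnt B n = cnt A n"
      using bal qj unfolding cA cB balanced_def by simp
    show "cnt B p = cnt A p" if "p \<in> X" for p
    proof (cases "p = q j")
      case True
      then show ?thesis
        using cnt_C_x[of j p] cnt_C_0[of "Suc j" "q (Suc j)"] cnt_C_0[of j p] xq qj assms
        unfolding cA cB by simp
    next
      case False
      then have "p \<in> N j - C j" using that by (simp add: X_def)
      then show ?thesis
        using C_diff(3)[OF assms(1,2), of p] N_before_q[OF assms(1,2), of p] False qj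
        unfolding cA cB by (cases "q j < p"; cases "q (Suc j) < p") auto
    qed
  qed
  then show ?thesis
  proof (rule s_op_balanced(2))
    fix p assume p: "p < n"
    define t where "t = b ! p"
    have t: "b ! p = t" by (simp add: t_def)
    note mem = C_letters[OF assms(1,2) p t]
    have mem': "p = q j \<Longrightarrow> t = j" "p = q (Suc j) \<Longrightarrow> t = Suc j" using bq t by auto
    have at: "up (Suc j) ! p = (if Suc j \<le> t \<and> t \<le> i \<and> p = x t then Suc t
         else if Suc j \<le> t \<and> t < i \<and> p \<notin> C t then Suc t else t)"
      "up j ! p = (if j \<le> t \<and> t \<le> i \<and> p = x t then Suc t
         else if j \<le> t \<and> t < i \<and> p \<notin> C t then Suc t else t)"
      using assms by (auto simp: nth_up[OF p t])
    have "up (Suc j) ! p = Suc j \<longleftrightarrow> t = Suc j \<and> p \<in> C (Suc j) \<and> p \<noteq> q (Suc j)"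
      unfolding at using mem xq assms by (cases "t = Suc j") auto
    then show "up (Suc j) ! p = Suc j \<longleftrightarrow> p \<in> A" using mem by (auto simp: A_def)
    have "up (Suc j) ! p = j \<longleftrightarrow> t = j" unfolding at by auto
    then show "up (Suc j) ! p = j \<longleftrightarrow> p \<in> B \<union> X" using mem mem' by (auto simp: B_def X_def)
    have "up j ! p = (if t = j \<and> (p = q j \<or> p \<notin> C j) then Suc j else up (Suc j) ! p)"
      unfolding at using xq assms by (cases "t = j") auto
    moreover have "p \<in> X \<longleftrightarrow> t = j \<and> (p = q j \<or> p \<notin> C j)" using mem(3) mem'(1) by (auto simp: X_def)
    ultimately show "up j ! p = (if p \<in> X then Suc j else up (Suc j) ! p)" by (simp only:)
  qed simp_all
qed

text \<open>Now \<open>x (Suc k)\<close> and \<open>q (Suc k)\<close> differ. The changed letter at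
  \<open>q k = r k\<close> stays as an opener replacing \<open>x (Suc k)\<close>, while
  \<open>q (Suc k)\<close> becomes unpaired and is lowered to \<open>k\<close>.\<close>

lemma s_op_up_k:
  assumes "k < i"
  shows "s_op k (Some (up k)) = Some (up (Suc k))"
proof -
  have k: "1 \<le> k" "k \<le> i" "x k = q k" by (rule k_props)+
  define A where "A = insert (q k) (C (Suc k) - {x (Suc k)} - {q (Suc k)})"
  define B where "B = C k - {q k}"
  define X where "X = insert (q (Suc k)) (N k - C k)"
  have qk: "q k \<in> C k" "q (Suc k) \<in> C (Suc k)" "x (Suc k) \<in> C (Suc k)" "q k < n" "q (Suc k) < n"
    using q_in x_in q_less k assms by auto
  have ord: "q (Suc k) < x (Suc k)" "x (Suc k) < q k"
    using k_greatest[of "Suc k"] x_Suc_less[of k] k assms by auto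
  have bq: "b ! q k = k" "b ! q (Suc k) = Suc k" "b ! x (Suc k) = Suc k" using b_q b_x k assms by auto
  note bal = C_balanced[OF k(1) assms]
  have qk': "q k \<notin> C (Suc k)" using bal qk by (auto simp: balanced_def)
  have cA: "cnt A p = cnt (C (Suc k)) p - of_bool (x (Suc k) < p) - of_bool (q (Suc k) < p) + of_bool (q k < p)" for p
    unfolding A_def using qk qk' ord by (simp add: cnt_remove cnt_insert)
  have cB: "cnt B p = cnt (C k) p - of_bool (q k < p)" for p
    unfolding B_def using qk by (simp add: cnt_remove)
  have "balanced A B X n"
    unfolding balanced_def
  proof (intro conjI allI ballI)
    show "A \<subseteq> {..<n}" "B \<subseteq> {..<n}" "X \<subseteq> {..<n}"
      using bal qk unfolding balanced_def A_def B_def X_def by auto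
    show "A \<inter> B = {}" "A \<inter> X = {}" "B \<inter> X = {}"
      using bal qk qk' unfolding balanced_def A_def B_def X_def by auto
    show "cnt B p \<le> cnt A p" for p
    proof -
      consider "q k < p" | "p \<le> q k" "x (Suc k) < p" | "p \<le> x (Suc k)" by force
      then show ?thesis
      proof cases
        case 1
        then show ?thesis using C_diff(1)[OF k(1) assms, of p] ord unfolding cA cB by simp
      next
        case 2
        have "1 \<le> cnt (C (Suc k)) (x (Suc k))" using cnt_C_pos ord assms by simp
        then show ?thesis using 2 cnt_C_x[of k p] cnt_C_0[of k p] k ord assms
          unfolding cA cB by simp
      next
        case 3
        then show ?thesis
          using cnt_C_0[of k p] cnt_C_pos[of "Suc k" p] cnt_nonneg[of "C (Suc k)" p] k ord assms
          unfolding cA cB by (cases "q (Suc k) < p") simp_all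
      qed
    qed
    show "cnt B n = cnt A n"
      using bal qk ord unfolding cA cB balanced_def by simp
    show "cnt B p = cnt A p" if "p \<in> X" for p
    proof (cases "p = q (Suc k)")
      case True
      then show ?thesis
        using cnt_C_0[of "Suc k" p] cnt_C_0[of k p] k ord assms
        unfolding cA cB by simp
    next
      case False
      then have pN: "p \<in> N k - C k" using that by (simp add: X_def)
      then have "p \<noteq> q k" using qk by auto
      with pN have "q (Suc k) < p \<longleftrightarrow> q k < p"
        using N_before_q[OF k(1) assms, of p] ord by force
      then show ?thesis
        using C_diff(3)[OF k(1) assms, of p] pN ord
        unfolding cA cB by (cases "q k < p") auto
    qed
  qed
  then show ?thesis
  proof (rule s_op_balanced(2))
    fix p assume p: "p < n"
    define t where "t = b ! p"
    have t: "b ! p = t" by (simp add: t_def)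
    note mem = C_letters[OF k(1) assms p t]
    have mem': "p = q k \<Longrightarrow> t = k" "p = q (Suc k) \<Longrightarrow> t = Suc k" "p = x (Suc k) \<Longrightarrow> t = Suc k"
      using bq t by auto
    have at: "up (Suc k) ! p = (if t = Suc k \<and> p = q t then t - 1
         else if t = k \<and> p = r t then Suc t
         else if Suc k \<le> t \<and> t \<le> i \<and> p = x t then Suc t
         else if Suc k \<le> t \<and> t < i \<and> p \<notin> C t then Suc t else t)"
      "up k ! p = (if k \<le> t \<and> t \<le> i \<and> p = x t then Suc t
         else if k \<le> t \<and> t < i \<and> p \<notin> C t then Suc t else t)"
      by (auto simp: nth_up[OF p t] le_Suc_eq less_Suc_eq)
    have "up (Suc k) ! p = Suc k \<longleftrightarrow> (t = k \<and> p = q k) \<or> (t = Suc k \<and> p \<in> C (Suc k) \<and> p \<noteq> q (Suc k) \<and> p \<noteq> x (Suc k))"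
      unfolding at using mem r_k k assms by (cases "t = Suc k"; cases "t = k") auto
    then show "up (Suc k) ! p = Suc k \<longleftrightarrow> p \<in> A" using mem mem' by (auto simp: A_def)
    have "up (Suc k) ! p = k \<longleftrightarrow> (t = k \<and> p \<noteq> q k) \<or> (t = Suc k \<and> p = q (Suc k))"
      unfolding at using r_k by (cases "t = Suc k"; cases "t = k") auto
    then show "up (Suc k) ! p = k \<longleftrightarrow> p \<in> B \<union> X" using mem mem' qk by (auto simp: B_def X_def)
    have "up k ! p = (if (t = k \<and> p \<notin> C k) \<or> (t = Suc k \<and> p = q (Suc k)) then Suc k else up (Suc k) ! p)"
      unfolding at using r_k k qk assms ord by (cases "t = k"; cases "t = Suc k") auto
    moreover have "p \<in> X \<longleftrightarrow> (t = k \<and> p \<notin> C k) \<or> (t = Suc k \<and> p = q (Suc k))"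
      using mem(3) mem'(2) by (auto simp: X_def)
    ultimately show "up k ! p = (if p \<in> X then Suc k else up (Suc k) ! p)" by (simp only:)
  qed simp_all
qed

text \<open>The letter \<open>j\<close> at \<open>r s\<close>, left by the previous step, closes an
  opener at \<open>r j\<close>. The change moves from \<open>x j\<close> to \<open>r j\<close>, and
  \<open>q'\<close> drops to \<open>j\<close> because its partner \<open>q j\<close> was already
  lowered.\<close>

lemma s_op_up_high:
  assumes "k < j" "j < i"
  shows "s_op j (Some (up j)) = Some (up (Suc j))"
proof -
  obtain s where s: "j = Suc s" using assms by (cases j) auto
  have s1: "1 \<le> s" "k \<le> s" "s < i" "1 \<le> j" "j \<le> i" using assms s k_props by auto
  define x' where "x' = x (Suc j)"
  define q' where "q' = q (Suc j)"
  define A where "A = insert (r j) (C (Suc j) - {x'} - {q'})"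
  define B where "B = insert (r s) (C j - {q j} - {x j})"
  define X where "X = (N j - C j) \<union> {q', x j} - {r j}"
  note bal = C_balanced[OF s1(4) assms(2)]
  have inC: "q j \<in> C j" "x j \<in> C j" "q' \<in> C (Suc j)" "x' \<in> C (Suc j)"
    using q_in x_in s1 assms by (auto simp: q'_def x'_def)
  have ord: "q' < q j" "q j < x j" "x j \<le> r j" "r j < r s" "q' < x'" "x' < x j"
    using q_Suc_less[of j] k_greatest[of j] k_greatest[of "Suc j"] x_le_r[of j] r_Suc(1)[of s]
      x_Suc_less[of j] s s1 assms by (auto simp: q'_def x'_def)
  have letter: "b ! q j = j" "b ! x j = j" "b ! q' = Suc j" "b ! x' = Suc j" "b ! r j = j" "b ! r s = s"
    using b_q b_x b_r s1 assms by (auto simp: q'_def x'_def)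
  have less: "q j < n" "x j < n" "q' < n" "x' < n" "r j < n" "r s < n"
    using inC C_less s1 assms r_N[of j] r_N[of s] pos_subset[of b] by auto
  \<comment> \<open>So either the change already sits at \<open>r j\<close>, or \<open>r j\<close>
    is off the chain and \<open>x j\<close> belongs to \<open>X\<close>.\<close>
  have rjC: "r j \<in> C j \<Longrightarrow> r j = x j"
    using no_C_between[of j "r j"] ord assms by auto
  have notC: "r j \<notin> C (Suc j)" "r s \<notin> C j"
    using letter_C[of "r j" "Suc j"] letter_C[of "r s" j] letter s s1 assms by auto
  have cA: "cnt A p = cnt (C (Suc j)) p - of_bool (x' < p) - of_bool (q' < p) + of_bool (r j < p)" for p
    unfolding A_def using inC notC ord by (simp add: cnt_remove cnt_insert)
  have cB: "cnt B p = cnt (C j) p - of_bool (q j < p) - of_bool (x j < p) + of_bool (r s < p)" for p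
    unfolding B_def using inC notC ord by (simp add: cnt_remove cnt_insert)
  have cnt_x': "cnt (C (Suc j)) p = cnt (C (Suc j)) x' + 1" if "x' < p" "p \<le> x j" for p
    using cnt_C_x[of j p] that s1 assms by (simp add: x'_def)
  have x'_pos: "1 \<le> cnt (C (Suc j)) x'" using cnt_C_pos[of "Suc j" x'] ord assms by (simp add: q'_def)
  have at_x: "cnt (C j) (x j) < cnt (C (Suc j)) (x j)" using C_diff(2) inC s1 assms by simp
  \<comment> \<open>The count of openers is constant on this interval and closers only accumulate,
    so the positive height at \<open>x j\<close> extends back to \<open>x'\<close>.\<close>
  have height_before_x: "cnt (C j) p < cnt (C (Suc j)) p" if "x' < p" "p \<le> x j" for p
  proof -
    have "cnt (C j) p \<le> cnt (C j) (x j)" using that by (intro cnt_mono)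
    then show ?thesis using at_x cnt_x'[OF that] cnt_x'[of "x j"] ord by simp
  qed
  have "balanced A B X n"
    unfolding balanced_def
  proof (intro conjI allI ballI)
    show "A \<subseteq> {..<n}" "B \<subseteq> {..<n}" "X \<subseteq> {..<n}"
      using bal less unfolding balanced_def A_def B_def X_def by auto
    show "A \<inter> B = {}" using bal notC rjC ord letter_C[of "r s" "Suc j"] letter s s1 assms
      unfolding balanced_def A_def B_def by auto
    show "A \<inter> X = {}" using bal inC unfolding balanced_def A_def X_def by auto
    show "B \<inter> X = {}" using bal inC letter s unfolding balanced_def B_def X_def by (auto simp: pos_def)
    show "cnt B p \<le> cnt A p" for p
    proof -
      have le: "cnt (C j) p \<le> cnt (C (Suc j)) p" using C_diff(1) s1 assms by simp
      consider "x j < p" | "q j < p" "p \<le> x j" | "p \<le> q j" "x' < p" | "p \<le> q j" "p \<le> x'"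
        by linarith
      then show ?thesis
      proof cases
        case 1
        then show ?thesis using le ord unfolding cA cB by simp
      next
        case 2
        then show ?thesis using le height_before_x[of p] ord
          unfolding cA cB by (cases "x' < p") simp_all
      next
        case 3
        then show ?thesis using cnt_C_0[of j p] cnt_x'[of p] x'_pos ord s1
          unfolding cA cB by simp
      next
        case 4
        then show ?thesis
          using cnt_C_0[of j p] cnt_C_pos[of "Suc j" p] cnt_nonneg[of "C (Suc j)" p] s1 ord assms
          unfolding cA cB q'_def[symmetric] by (cases "q' < p") simp_all
      qed
    qed
    show "cnt B n = cnt A n"
      using bal less unfolding cA cB balanced_def by simp
    show "cnt B p = cnt A p" if pX: "p \<in> X" for p
    proof -
      consider "p = q'" | "p = x j" "p \<noteq> r j" | "p \<in> N j - C j" "p \<noteq> r j"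
        using pX by (auto simp: X_def)
      then show ?thesis
      proof cases
        case 1
        then show ?thesis
          using cnt_C_0[of "Suc j" p] cnt_C_0[of j p] s1 ord assms
          unfolding cA cB by (simp add: q'_def)
      next
        case 2
        then have rj: "r j \<in> N j" "r j \<notin> C j" using rjC r_N[of j] s1 by auto
        \<comment> \<open>Only \<open>x j\<close> itself contributes a closer up to
          \<open>r j\<close>. As \<open>r j\<close> is at height zero, this fixes the height at
          \<open>x j\<close> to be exactly 1.\<close>
        have "cnt (C j) (r j) = cnt (C j) (Suc (x j))"
        proof (rule ccontr)
          assume "cnt (C j) (r j) \<noteq> cnt (C j) (Suc (x j))"
          moreover have "cnt (C j) (Suc (x j)) \<le> cnt (C j) (r j)"
            using 2 ord by (intro cnt_mono) simp
          ultimately have "cnt (C j) (Suc (x j)) < cnt (C j) (r j)" by simp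
          then obtain y where "y \<in> C j" "Suc (x j) \<le> y" "y < r j" by (rule cnt_less_elem)
          then show False using no_C_between[of j y] assms by simp
        qed
        also have "\<dots> = cnt (C j) (x j) + 1" using inC by (simp add: cnt_Suc)
        finally have "cnt (C (Suc j)) (r j) = cnt (C j) (x j) + 1"
          using C_diff(3)[of j "r j"] rj s1 assms by simp
        moreover have "cnt (C (Suc j)) (x j) \<le> cnt (C (Suc j)) (r j)"
          using ord by (intro cnt_mono) simp
        ultimately have "cnt (C (Suc j)) (x j) = cnt (C j) (x j) + 1" using at_x by simp
        then show ?thesis using 2 ord unfolding cA cB by simp
      next
        case 3
        have eq: "cnt (C j) p = cnt (C (Suc j)) p" using C_diff(3)[of j p] 3 s1 assms by simp
        have "p \<noteq> q j" "p \<noteq> x j" "p \<noteq> r s" using 3 inC letter s by (auto simp: pos_def)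
        moreover have "q' < p \<Longrightarrow> q j \<le> p"
          using N_before_q[of j p] 3 s1 assms by (simp add: q'_def)
        moreover have "p < r s \<Longrightarrow> p \<le> r j" using r_Suc(3)[of s p] 3 s s1 by simp
        moreover have "\<not> (x' < p \<and> p \<le> x j)" using height_before_x[of p] eq by auto
        \<comment> \<open>Letters \<open>j\<close> off the chain avoid the gaps from
          \<open>q'\<close> to \<open>q j\<close>, from \<open>x'\<close> to \<open>x j\<close> and
          from \<open>r j\<close> to \<open>r s\<close>. In the four remaining ranges the
          corrections in \<open>cA\<close> and \<open>cB\<close> cancel.\<close>
        ultimately consider "p \<le> q'" | "q j < p" "p \<le> x'" | "x j < p" "p < r j" | "r s < p"
          using \<open>p \<noteq> r j\<close> by linarith
        then show ?thesis using eq ord unfolding cA cB by cases simp_all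
      qed
    qed
  qed
  then show ?thesis
  proof (rule s_op_balanced(2))
    fix p assume p: "p < n"
    define t where "t = b ! p"
    have t: "b ! p = t" by (simp add: t_def)
    note mem = C_letters[OF s1(4) assms(2) p t]
    have mem': "p = q j \<Longrightarrow> t = j" "p = x j \<Longrightarrow> t = j" "p = r j \<Longrightarrow> t = j"
      "p = q' \<Longrightarrow> t = Suc j" "p = x' \<Longrightarrow> t = Suc j" "p = r s \<Longrightarrow> t = s"
      using letter t by auto
    have ne: "q j \<noteq> r j" "q j \<noteq> x j" "q' \<noteq> x'" using ord by auto
    have at: "up (Suc j) ! p = (if k < t \<and> t \<le> Suc j \<and> p = q t then t - 1
        else if k \<le> t \<and> t < Suc j \<and> p = r t then Suc t
        else if Suc j \<le> t \<and> t \<le> i \<and> p = x t then Suc t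
        else if Suc j \<le> t \<and> t < i \<and> p \<notin> C t then Suc t else t)"
      "up j ! p = (if k < t \<and> t \<le> j \<and> p = q t then t - 1
        else if k \<le> t \<and> t < j \<and> p = r t then Suc t
        else if j \<le> t \<and> t \<le> i \<and> p = x t then Suc t
        else if j \<le> t \<and> t < i \<and> p \<notin> C t then Suc t else t)"
      by (rule nth_up[OF p t])+
    have lt: "k < j" "k \<le> j" "j < i" "j \<le> i" "j - 1 = s" "s < j" "Suc j \<le> i"
      using s s1 assms by auto
    consider "t = j" | "t = Suc j" | "t < j" | "Suc j < t" by linarith
    then have "(up (Suc j) ! p = Suc j \<longleftrightarrow>
          (t = j \<and> p = r j) \<or> (t = Suc j \<and> p \<in> C (Suc j) \<and> p \<noteq> q' \<and> p \<noteq> x')) \<and>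
        (up (Suc j) ! p = j \<longleftrightarrow>
          (t = s \<and> p = r s) \<or> (t = j \<and> p \<noteq> r j \<and> p \<noteq> q j) \<or> (t = Suc j \<and> p = q')) \<and>
        up j ! p = (if (t = j \<and> (p \<notin> C j \<or> p = x j) \<and> p \<noteq> r j) \<or> (t = Suc j \<and> p = q')
          then Suc j else up (Suc j) ! p)"
    proof cases
      case 1
      have "up (Suc j) ! p = (if p = q j then s else if p = r j then Suc j else j)"
        unfolding at 1 using lt by simp
      moreover have "up j ! p = (if p = q j then s else if p = x j \<or> p \<notin> C j then Suc j else j)"
        unfolding at 1 using lt by simp
      moreover have "j \<noteq> s" "j \<noteq> Suc j" using lt by auto
      ultimately show ?thesis
        using ne inC(1) rjC lt(6) 1 by (cases "p = q j"; cases "p = r j") auto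
    next
      case 2
      have "up (Suc j) ! p = (if p = q' then j else if p = x' \<or> p \<notin> C (Suc j) then Suc (Suc j) else Suc j)"
        unfolding at 2 q'_def x'_def using lt mem(4)[OF 2] by auto
      moreover have "up j ! p = (if p = x' \<or> p \<notin> C (Suc j) then Suc (Suc j) else Suc j)"
        unfolding at 2 x'_def using lt mem(4)[OF 2] by auto
      ultimately show ?thesis
        using ne inC(3) lt(6) 2 by (cases "p = q'"; cases "p = x'") auto
    next
      case 3
      have "up (Suc j) ! p = (if k < t \<and> p = q t then t - 1 else if k \<le> t \<and> p = r t then Suc t else t)"
        unfolding at using 3 by simp
      moreover have "up j ! p = (if k < t \<and> p = q t then t - 1 else if k \<le> t \<and> p = r t then Suc t else t)"
        unfolding at using 3 by simp
      moreover have "q t \<noteq> r t" if "k < t"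
        using k_greatest[of t] x_le_r[of t] that 3 lt by simp
      ultimately show ?thesis
        using 3 s s1(2) by (cases "t = s") auto
    next
      case 4
      then have "up (Suc j) ! p \<in> {t, Suc t}" "up j ! p = up (Suc j) ! p"
        unfolding at by auto
      then show ?thesis using 4 lt(6) by auto
    qed
    moreover have "p \<in> A \<longleftrightarrow>
        (t = j \<and> p = r j) \<or> (t = Suc j \<and> p \<in> C (Suc j) \<and> p \<noteq> q' \<and> p \<noteq> x')"
      using mem(2) mem'(3) by (auto simp: A_def)
    moreover have pX: "p \<in> X \<longleftrightarrow>
        (t = j \<and> (p \<notin> C j \<or> p = x j) \<and> p \<noteq> r j) \<or> (t = Suc j \<and> p = q')"
      using mem(3) mem'(2,3,4) letter by (auto simp: X_def)
    moreover have "p \<in> B \<union> X \<longleftrightarrow>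
        (t = s \<and> p = r s) \<or> (t = j \<and> p \<noteq> r j \<and> p \<noteq> q j) \<or> (t = Suc j \<and> p = q')"
    proof -
      have "p \<in> B \<longleftrightarrow> (t = s \<and> p = r s) \<or> (t = j \<and> p \<in> C j \<and> p \<noteq> q j \<and> p \<noteq> x j)"
        using mem(1) mem'(6) by (auto simp: B_def)
      with pX show ?thesis using inC(1) rjC ne by blast
    qed
    ultimately show "up (Suc j) ! p = Suc j \<longleftrightarrow> p \<in> A" "up (Suc j) ! p = j \<longleftrightarrow> p \<in> B \<union> X"
      "up j ! p = (if p \<in> X then Suc j else up (Suc j) ! p)"
      by (simp_all only:)
  qed simp_all
qed

section \<open>Assembling the result\<close>

lemma f_neg_eq_up: "f_neg i (Some b) = Some (up i)"
proof -
  have "s_prod (rev [1..<i]) (Some (up 1)) = Some (up i)"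
  proof (rule s_prod_rev_upt)
    show "s_op j (Some (up j)) = Some (up (Suc j))" if "1 \<le> j" "j < i" for j
      using that s_op_up_low[of j] s_op_up_k s_op_up_high[of j] by (cases j k rule: linorder_cases) auto
  qed (rule i)
  then show ?thesis
    using forward f_neg_one_v(3) down_top unfolding f_neg_def up_1 by simp
qed

text \<open>All letters \<open>i\<close> form the top of the chain, so \<open>r i\<close> is on it
  and \<open>no_C_between\<close> forces \<open>x i = r i\<close>. The last change at
  \<open>x i\<close> is thus one at \<open>r i\<close>.\<close>

lemma up_i: "up i = map (\<lambda>p. if \<exists>t\<in>{k + 1..i}. p = q t then b ! p - 1
    else if \<exists>t\<in>{k..i}. p = r t then b ! p + 1 else b ! p) [0..<n]"
proof (rule nth_equalityI)
  fix p assume "p < length (up i)"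
  then have p: "p < n" by simp
  define t where "t = b ! p"
  have t: "b ! p = t" by (simp add: t_def)
  have 1: "(\<exists>t\<in>{k + 1..i}. p = q t) \<longleftrightarrow> k < t \<and> t \<le> i \<and> p = q t"
    using b_q t k_props by force
  have 2: "(\<exists>t\<in>{k..i}. p = r t) \<longleftrightarrow> k \<le> t \<and> t \<le> i \<and> p = r t"
    using b_r t k_props by force
  have "r i \<in> C i" using r_N[of i] chain_top[of b i] i by simp
  then have "x i = r i" using no_C_between[of i "r i"] x_le_r[of i] k_props i by simp
  then have 3: "i \<le> t \<and> t \<le> i \<and> p = x t \<longleftrightarrow> t = i \<and> p = r t" by auto
  show "up i ! p = map (\<lambda>p. if \<exists>t\<in>{k + 1..i}. p = q t then b ! p - 1
    else if \<exists>t\<in>{k..i}. p = r t then b ! p + 1 else b ! p) [0..<n] ! p"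
    (is "_ = ?rhs")
  proof -
    have "?rhs = (if k < t \<and> t \<le> i \<and> p = q t then t - 1
        else if k \<le> t \<and> t \<le> i \<and> p = r t then t + 1 else t)"
      using p by (simp only: nth_map length_upt nth_upt diff_zero add_0 1 2 t)
    moreover have "up i ! p = (if k < t \<and> t \<le> i \<and> p = q t then t - 1
        else if k \<le> t \<and> t < i \<and> p = r t then Suc t
        else if t = i \<and> p = r t then Suc t else if i \<le> t \<and> t < i \<and> p \<notin> C t then Suc t else t)"
      by (simp only: nth_up[OF p t] 3)
    ultimately show ?thesis
      using k_props(2) by (cases "t = i"; cases "p = r t"; cases "p = q t") simp_all
  qed
qed simp

end

text \<open>Inductively \<open>q t\<close> is at most \<open>r t\<close>, so
  \<open>q (Suc t)\<close> is always a candidate for the next position and no \<open>Max\<close> of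
  an empty set occurs.\<close>

lemma ex_leftward_seq: "\<exists>r. leftward_seq i b (q 1) r"
proof -
  define path where "path = rec_nat (q 1) (\<lambda>d y. Max {p. p < y \<and> p \<in> N (Suc (Suc d))})"
  define r where "r t = path (t - 1)" for t
  have r1: "r 1 = q 1" by (simp add: r_def path_def)
  have rS: "r (Suc t) = Max {p. p < r t \<and> p \<in> N (Suc t)}" if "1 \<le> t" for t
    using that by (cases t) (simp_all add: r_def path_def)
  have step: "r (Suc t) \<in> {p. p < r t \<and> p \<in> N (Suc t)}" if "1 \<le> t" "t < i" "q t \<le> r t" for t
  proof -
    have "q (Suc t) \<in> {p. p < r t \<and> p \<in> N (Suc t)}"
      using that q_Suc_less[of t] q_in[of "Suc t"] C_subset[of "Suc t"] by auto
    then show ?thesis unfolding rS[OF that(1)] by (intro Max_in) auto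
  qed
  have upper: "p \<le> r (Suc t)" if "1 \<le> t" "p < r t" "p \<in> N (Suc t)" for p t
    unfolding rS[OF that(1)] using that by (intro Max_ge) auto
  have q_le_r: "q t \<le> r t" if "1 \<le> t" "t \<le> i" for t
    using that
  proof (induction t rule: dec_induct)
    case base
    show ?case by (simp add: r1)
  next
    case (step t)
    then show ?case
      using q_Suc_less[of t] q_in[of "Suc t"] C_subset[of "Suc t"] by (intro upper) auto
  qed
  have "r t < r (t - 1) \<and> b ! r t = t \<and> (\<forall>p. r t < p \<and> p < r (t - 1) \<longrightarrow> b ! p \<noteq> t)"
    if t: "1 < t" "t \<le> i" for t
  proof -
    obtain s where s: "t = Suc s" "1 \<le> s" "s < i" using t by (cases t) auto
    have 1: "r t < r s" "r t \<in> N t" using step[of s] q_le_r[of s] s by auto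
    have "b ! p \<noteq> t" if p: "r t < p" "p < r s" for p
    proof
      assume "b ! p = t"
      \<comment> \<open>Membership in \<open>N t\<close> needs a position inside the word;
        \<open>b ! p = t\<close> does not ensure that.\<close>
      have "r s < n"
      proof (cases "s = 1")
        case True
        then show ?thesis using r1 q_less[of 1] i by simp
      next
        case False
        then obtain s' where "s = Suc s'" "1 \<le> s'" "s' < i" using s by (cases s) auto
        then show ?thesis using step[of s'] q_le_r[of s'] pos_subset[of b s] by auto
      qed
      then have "p \<in> N t" using p \<open>b ! p = t\<close> by (simp add: pos_def)
      then show False using upper[of s p] p s by simp
    qed
    then show ?thesis using 1 s by (auto simp: pos_def)
  qed
  then show ?thesis unfolding leftward_seq_def using r1 by blast
qed

end

theorem theorem2p12:
  fixes n l i :: nat and b :: word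
  assumes "n \<ge> 1" and "l \<ge> 1" and "i \<in> {1..n}"
    and "b \<in> words n l"
    and "highest_weight {1..i} b"
    and "phi_neg i b = 1"
  shows "(\<exists>q r. initial_seq i b q \<and> leftward_seq i b (q 1) r) \<and>
    (\<forall>q r k. initial_seq i b q \<longrightarrow> leftward_seq i b (q 1) r \<longrightarrow>
       k = Max {j \<in> {1..i}. q j = r j} \<longrightarrow>
       f_neg i (Some b) = Some (map (\<lambda>p.
         if \<exists>j\<in>{k + 1..i}. p = q j then b ! p - 1
         else if \<exists>j\<in>{k..i}. p = r j then b ! p + 1
         else b ! p) [0..<length b]))"
proof -
  have i: "1 \<le> i" using assms(3) by simp
  \<comment> \<open>If the operator killed \<open>b\<close>, so would all its positive powers, and
    \<open>phi_neg i b\<close> would be 0 instead of 1.\<close>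
  have "f_neg i (Some b) \<noteq> None"
  proof
    assume none: "f_neg i (Some b) = None"
    have "f_neg i None = None"
      by (simp add: f_neg_def s_prod_None f_neg_one_def)
    then have "(f_neg i ^^ Suc m) (Some b) = None" for m
      using none by (induction m) simp_all
    then have "(f_neg i ^^ m) (Some b) \<noteq> None \<longleftrightarrow> m \<le> 0" for m
      by (cases m) simp_all
    then have "phi_neg i b = 0" by (rule max_power_eqI)
    with assms(6) show False by simp
  qed
  then interpret queer_highest_weight b i
    using i assms(5) by unfold_locales
  show ?thesis
  proof (intro conjI allI impI)
    show "\<exists>q r. initial_seq i b q \<and> leftward_seq i b (q 1) r"
      using initial_seq_q ex_leftward_seq by blast
  next
    fix q' r m
    assume q': "initial_seq i b q'" and r: "leftward_seq i b (q' 1) r"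
      and m: "m = Max {j \<in> {1..i}. q' j = r j}"
    have eq: "q' t = q t" if "1 \<le> t" "t \<le> i" for t
      using initial_seq_unique[OF q' that] .
    have r': "leftward_seq i b (q 1) r" using r eq[of 1] i by simp
    have "{j \<in> {1..i}. q' j = r j} = {t \<in> {1..i}. q t = r t}" using eq by auto
    then have m: "m = k" using m Max_eq_k[OF r'] by simp
    have "p = q' j \<longleftrightarrow> p = q j" if "j \<in> {k + 1..i}" for p j
      using eq[of j] that by simp
    then have "(\<exists>j\<in>{k + 1..i}. p = q' j) \<longleftrightarrow> (\<exists>j\<in>{k + 1..i}. p = q j)" for p
      by blast
    then show "f_neg i (Some b) = Some (map (\<lambda>p.
         if \<exists>j\<in>{m + 1..i}. p = q' j then b ! p - 1
         else if \<exists>j\<in>{m..i}. p = r j then b ! p + 1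
         else b ! p) [0..<length b])"
      unfolding m f_neg_eq_up[OF r'] up_i[OF r'] by presburger
  qed
qed

end
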